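(* Let $n\ge1$, let $X_j\sim\mathrm{LN}(\mu_j,\sigma_j^2)$ with $\mu_j\in\mathbb{R}$, $\sigma_j>0$, $j=1,\ldots,n$, be independent, and let $X=\sum_{j=1}^n X_j$. Then $X$ has probability density function $$f_X(x)=-\frac1\pi\int_0^\infty \operatorname{Im}\left[\phi(-t+i\cdot 0)\right]e^{-tx}\,dt,\qquad x>0,$$ where $\phi$ is the (analytically continued) Laplace transform of $X$ and $\phi(-t+i\cdot0)=\lim_{\epsilon\to0^+}\phi(-t+i\epsilon)$.
   Context: $Y\sim\mathrm{LN}(\mu,\sigma^2)$ (lognormal, $\mu\in\mathbb{R}$, $\sigma>0$) means that $Y$ is a positive random variable with density $\frac{1}{\sqrt{2\pi}\,\sigma x}\exp\left[-\frac{(\ln x-\mu)^2}{2\sigma^2}\right]$, $x>0$. The Laplace transform of $X$ is $\phi(z)=\mathbb{E}[e^{-zX}]=\prod_{j=1}^n\phi_j(z)$, where $\phi_j(z)=\mathbb{E}[e^{-zX_j}]$, for $\operatorname{Re}(z)\ge0$; $\phi$ and $\phi_j$ also denote the (unique) analytic continuations of these functions from $\{\operatorname{Re}(z)>0\}$ to $\mathbb{C}\setminus(-\infty,0]$. Explicitly, for $z\in\mathbb{C}\setminus(-\infty,0]$, $\phi_j(z)=(2\pi\sigma_j^2)^{-1/2}e^{-(\mu_j+\ln z)^2/(2\sigma_j^2)}\int_0^\infty \frac1x\exp\left[-x-\frac{(\ln x)^2}{2\sigma_j^2}+\frac{(\mu_j+\ln z)\ln x}{\sigma_j^2}\right]dx$,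 with $\ln$ the principal branch of the logarithm, and $\phi=\prod_{j=1}^n\phi_j$. *)

theory Defs
  imports "HOL-Probability.Probability" "HOL-Complex_Analysis.Complex_Analysis"
begin

text \<open>Nonnegativity is required explicitly because \<open>ennreal\<close> maps negative reals to \<open>0\<close>.\<close>

definition has_pdf :: "'a measure \<Rightarrow> ('a \<Rightarrow> real) \<Rightarrow> (real \<Rightarrow> real) \<Rightarrow> bool" where
  "has_pdf M Y f \<longleftrightarrow> (\<forall>x. 0 \<le> f x) \<and> distributed M lborel Y (\<lambda>x. ennreal (f x))"

definition lognormal_density :: "real \<Rightarrow> real \<Rightarrow> real \<Rightarrow> real" where
  "lognormal_density \<mu> \<sigma> x =
     (if x > 0
      then 1 / (sqrt (2 * pi) * \<sigma> * x) * exp (- ((ln x - \<mu>)\<^sup>2 / (2 * \<sigma>\<^sup>2)))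
      else 0)"

definition laplace_transform :: "'a measure \<Rightarrow> ('a \<Rightarrow> real) \<Rightarrow> complex \<Rightarrow> complex" where
  "laplace_transform M Y z = (LINT \<omega>|M. exp (- z * complex_of_real (Y \<omega>)))"

definition laplace_continuation ::
  "'a measure \<Rightarrow> ('a \<Rightarrow> real) \<Rightarrow> (complex \<Rightarrow> complex) \<Rightarrow> bool" where
  "laplace_continuation M Y \<phi> \<longleftrightarrow>
     \<phi> holomorphic_on (- \<real>\<^sub>\<le>\<^sub>0) \<and> (\<forall>z. Re z > 0 \<longrightarrow> \<phi> z = laplace_transform M Y z)"

lemma laplace_continuation_unique:
  assumes "laplace_continuation M Y \<phi>" "laplace_continuation M Y \<psi>" "z \<notin> \<real>\<^sub>\<le>\<^sub>0"
  shows "\<phi> z = \<psi> z"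
proof (rule analytic_continuation_open[where f = \<phi> and g = \<psi>
      and s = "{z. Re z > 0}" and s' = "- \<real>\<^sub>\<le>\<^sub>0"])
  show "open {z. Re z > 0}"
    by (rule open_halfspace_Re_gt)
  show "open (- \<real>\<^sub>\<le>\<^sub>0 :: complex set)"
    by auto
  have "1 \<in> {z. Re z > 0}"
    by simp
  then show "{z. Re z > 0} \<noteq> {}"
    by blast
  have "\<real>\<^sub>\<le>\<^sub>0 = complex_of_real ` {..0}"
    by (auto simp: nonpos_Reals_def)
  then show "connected (- \<real>\<^sub>\<le>\<^sub>0 :: complex set)"
    using starlike_imp_connected[OF starlike_slotted_complex_plane_left[of 0]] by simp
  show "{z. Re z > 0} \<subseteq> - \<real>\<^sub>\<le>\<^sub>0"
    by (auto simp: complex_nonpos_Reals_iff)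
qed (use assms in \<open>auto simp: laplace_continuation_def\<close>)

text \<open>Because the continuation is only determined off the cut, it is chosen with \<open>SOME\<close>; its values
  on the cut are arbitrary and never used. By the preceding lemma its values off the cut do not
  depend on the choice.\<close>

definition laplace_ext :: "'a measure \<Rightarrow> ('a \<Rightarrow> real) \<Rightarrow> complex \<Rightarrow> complex" where
  "laplace_ext M Y = (SOME \<phi>. laplace_continuation M Y \<phi>)"

text \<open>The boundary value \<open>\<phi>(-t + i\<cdot>0)\<close> on the upper side of the cut.\<close>

definition upper_boundary_value :: "(complex \<Rightarrow> complex) \<Rightarrow> real \<Rightarrow> complex" where
  "upper_boundary_value \<phi> t = Lim (at_right 0) (\<lambda>\<epsilon>. \<phi> (Complex (- t) \<epsilon>))"

end

theory Submission
  imports Defs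
begin

text \<open>In the variable \<open>w = ln z\<close> each \<open>\<phi>\<^sub>j\<close> becomes an entire function, bounded on the strip
  \<open>\<bar>Im w\<bar> \<le> \<pi>\<close> and tending to \<open>0\<close> as \<open>Re w \<rightarrow> \<infinity>\<close>; this gives the continuation of \<open>\<phi>\<close>, its boundary
  values on the cut and their boundedness at once. Levy's inversion formula expresses the
  probability of \<open>{a<..b}\<close>, \<open>0 < a\<close>, as an integral of \<open>\<phi>(z) (e\<^bsup>bz\<^esup> - e\<^bsup>az\<^esup>) / z\<close> along the imaginary axis. In
  the second quadrant both exponentials are bounded, so Cauchy's theorem moves the path onto the upper
  side of the cut, and Fubini's theorem turns the result into \<open>\<integral>\<^sub>a\<^sup>b f\<^sub>X\<close>. As \<open>f\<^sub>X\<close> is continuous, the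
  nonnegativity of these probabilities gives \<open>f\<^sub>X \<ge> 0\<close> pointwise.\<close>

section \<open>Holomorphic parameter integrals\<close>

text \<open>About the size of \<phi> the argument uses only that it is bounded and tends to 0 at
  infinity, uniformly over the closed quadrant; no rate is available. Hence the integral along the
  imaginary axis is handled as a limit of truncated integrals, never as an absolutely convergent
  one. At 0 the difference of the two exponentials cancels the pole of 1/z, so the connecting path
  near 0 contributes little; far out, 1/z offsets the length of the path and the decay of \<phi>
  does the rest. On the cut, a > 0 leaves a factor exp(-at), and everything converges absolutely.
  The bound on the strip comes from the Gaussian factor: passing from Re w to w multiplies the
  modulus of the integrand by exp((Im w)^2 / (2 \<sigma>^2)), and Im w = \<pi> is the upper side of
  the cut. The substitution z = \<i>\<zeta> turns the second quadrant into the first, where ln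
  \<zeta> + \<i>\<pi>/2 is holomorphic across both edges.\<close>

lemma holomorphic_on_lebesgue_integral:
  fixes f :: "complex \<Rightarrow> 'a \<Rightarrow> complex"
  assumes "open S"
    and meas: "\<And>z. z \<in> S \<Longrightarrow> f z \<in> borel_measurable M"
    and hol: "\<And>x. x \<in> space M \<Longrightarrow> (\<lambda>z. f z x) holomorphic_on S"
    and dom: "\<And>z. z \<in> S \<Longrightarrow> \<exists>r>0. \<exists>g. ball z r \<subseteq> S \<and> integrable M g \<and>
                (AE x in M. \<forall>w\<in>ball z r. norm (f w x) \<le> g x)"
  shows "(\<lambda>z. LINT x|M. f z x) holomorphic_on S"
proof -
  let ?F = "\<lambda>z. LINT x|M. f z x"
  have "?F field_differentiable (at z)" if z: "z \<in> S" for z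
  proof -
    obtain r g where r: "r > 0" "ball z r \<subseteq> S" and g: "integrable M g"
      and bd: "AE x in M. \<forall>w\<in>ball z r. norm (f w x) \<le> g x"
      using dom[OF z] by blast
    have inS: "w \<in> S" if "w \<in> ball z r" for w using that r by blast
    have int: "integrable M (f w)" if "w \<in> ball z r" for w
    proof (rule Bochner_Integration.integrable_bound[OF g meas[OF inS[OF that]]])
      show "AE x in M. norm (f w x) \<le> norm (g x)"
        using bd by eventually_elim (use that in force)
    qed
    define D where "D x = deriv (\<lambda>w. f w x) z" for x
    have derD: "((\<lambda>w. f w x) has_field_derivative D x) (at z)" if "x \<in> space M" for x
      unfolding D_def using holomorphic_derivI[OF hol[OF that] assms(1) z] .
    \<comment> \<open>Only \<open>f\<close> itself is dominated. Cauchy's inequality on circles of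
      radius r/3 about points of the ball of radius r/2 (and r/2 + r/3 < r) bounds the derivative,
      and the mean value inequality then dominates the difference quotients.\<close>
    have quot: "norm ((f w x - f z x) / (w - z)) \<le> 3 / r * g x"
      if b: "\<forall>w\<in>ball z r. norm (f w x) \<le> g x" and x: "x \<in> space M"
        and w: "w \<in> ball z (r/2)" "w \<noteq> z" for w x
    proof -
      have "norm (deriv (\<lambda>w. f w x) u) \<le> 3 / r * g x" if u: "u \<in> ball z (r/2)" for u
      proof -
        have sub: "cball u (r/3) \<subseteq> ball z r"
        proof
          fix y assume "y \<in> cball u (r/3)"
          then have "dist z y \<le> dist z u + r/3"
            using dist_triangle[of z y u] by (simp add: dist_commute)
          then show "y \<in> ball z r" using u r by simp
        qed
        have "norm ((deriv ^^ 1) (\<lambda>w. f w x) u) \<le> fact 1 * g x / (r/3) ^ 1"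
        proof (rule Cauchy_inequality)
          show "(\<lambda>w. f w x) holomorphic_on ball u (r/3)"
            by (rule holomorphic_on_subset[OF hol[OF x]]) (use sub r ball_subset_cball in blast)
          show "continuous_on (cball u (r/3)) (\<lambda>w. f w x)"
            by (rule holomorphic_on_imp_continuous_on, rule holomorphic_on_subset[OF hol[OF x]])
              (use sub r in blast)
          show "norm (f y x) \<le> g x" if "norm (u - y) = r/3" for y
          proof -
            have "y \<in> cball u (r/3)" using that by (simp add: dist_norm)
            then show ?thesis using b sub by blast
          qed
        qed (use r in auto)
        then show ?thesis by (simp add: field_simps)
      qed
      then have "norm (f w x - f z x) \<le> 3 / r * g x * norm (w - z)"
      proof (intro field_differentiable_bound[where S = "ball z (r/2)" and f' = "deriv (\<lambda>w. f w x)"])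
        fix u assume u: "u \<in> ball z (r/2)"
        then have "u \<in> S" using inS r by simp
        then show "((\<lambda>w. f w x) has_field_derivative deriv (\<lambda>w. f w x) u) (at u within ball z (r/2))"
          using holomorphic_derivI[OF hol[OF x] assms(1)] by blast
      qed (use w r in auto)
      then show ?thesis using w(2) by (simp add: norm_divide divide_le_eq)
    qed
    have "((\<lambda>w. (?F w - ?F z) / (w - z)) \<longlongrightarrow> (LINT x|M. D x)) (at z)"
      unfolding tendsto_at_iff_sequentially comp_def
    proof (intro allI impI)
      fix X assume X: "\<forall>i. X i \<in> UNIV - {z}" "X \<longlonglongrightarrow> z"
      have "eventually (\<lambda>i. X i \<in> ball z (r/2)) sequentially"
        using X(2) r by (intro topological_tendstoD) auto
      then obtain N where N: "\<And>i. i \<ge> N \<Longrightarrow> X i \<in> ball z (r/2)"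
        unfolding eventually_sequentially by blast
      have N': "X (i + N) \<in> ball z (r/2)" "X (i + N) \<noteq> z" for i using N X by auto
      have in2: "X (i + N) \<in> ball z r" for i using N'(1)[of i] r by simp
      have lim: "(\<lambda>i. (f (X (i + N)) x - f z x) / (X (i + N) - z)) \<longlonglongrightarrow> D x"
        if "x \<in> space M" for x
      proof -
        have "((\<lambda>w. (f w x - f z x) / (w - z)) \<longlongrightarrow> D x) (at z)"
          using derD[OF that] by (simp add: has_field_derivative_iff)
        then have "(\<lambda>i. (f (X i) x - f z x) / (X i - z)) \<longlonglongrightarrow> D x"
          unfolding tendsto_at_iff_sequentially comp_def using X by blast
        then show ?thesis by (rule LIMSEQ_ignore_initial_segment)
      qed
      have [measurable]: "f (X (i + N)) \<in> borel_measurable M" "f z \<in> borel_measurable M" for i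
        using meas inS in2 z by auto
      have "(\<lambda>i. LINT x|M. (f (X (i + N)) x - f z x) / (X (i + N) - z)) \<longlonglongrightarrow> (LINT x|M. D x)"
      proof (rule integral_dominated_convergence)
        show "integrable M (\<lambda>x. 3 / r * g x)" using g by simp
        \<comment> \<open>The derivative is measurable as the pointwise limit of the difference
          quotients.\<close>
        show "D \<in> borel_measurable M"
          by (rule borel_measurable_LIMSEQ_metric[OF _ lim]) measurable
        show "AE x in M. norm ((f (X (i + N)) x - f z x) / (X (i + N) - z)) \<le> 3 / r * g x" for i
          using bd by (rule AE_mp) (intro AE_I2 impI quot N', auto)
        show "AE x in M. (\<lambda>i. (f (X (i + N)) x - f z x) / (X (i + N) - z)) \<longlonglongrightarrow> D x"
          by (intro AE_I2 lim)
      qed measurable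
      moreover have "(LINT x|M. (f (X (i + N)) x - f z x) / (X (i + N) - z)) =
          (?F (X (i + N)) - ?F z) / (X (i + N) - z)" for i
        using int[OF in2] int[of z] r by simp
      ultimately have "(\<lambda>i. (?F (X (i + N)) - ?F z) / (X (i + N) - z)) \<longlonglongrightarrow> (LINT x|M. D x)"
        by (simp only:)
      then show "(\<lambda>i. (?F (X i) - ?F z) / (X i - z)) \<longlonglongrightarrow> (LINT x|M. D x)"
        by (rule LIMSEQ_offset)
    qed
    then show ?thesis
      unfolding field_differentiable_def has_field_derivative_iff by blast
  qed
  then show ?thesis
    using assms(1) holomorphic_on_open field_differentiable_def by blast
qed

section \<open>Lognormal Laplace transforms in the logarithmic variable\<close>

text \<open>The left side is x for x < 1 and 1/x^3 for x >= 1, so it is small enough at both ends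
  for an integrable majorant.\<close>

lemma exp_neg_2_abs_ln_le:
  fixes x :: real
  assumes "x > 0"
  shows "exp (- 2 * \<bar>ln x\<bar>) / x \<le> 2 * inverse (1 + x\<^sup>2)"
proof -
  have pos: "1 + x\<^sup>2 > 0" by (simp add: add_pos_nonneg)
  have "exp (- 2 * \<bar>ln x\<bar>) / x * (1 + x\<^sup>2) \<le> 2"
  proof (cases "x \<ge> 1")
    case True
    have "exp (- 2 * \<bar>ln x\<bar>) = inverse (x\<^sup>2)"
      using True by (simp add: exp_minus exp_of_nat_mult[of 2, simplified])
    then have "exp (- 2 * \<bar>ln x\<bar>) / x * (1 + x\<^sup>2) = inverse (x ^ 3) + inverse x"
      using assms by (simp only:) (simp add: field_simps power2_eq_square power3_eq_cube)
    moreover have "inverse (x ^ 3) \<le> 1" "inverse x \<le> 1"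
      using True by (auto simp: inverse_le_1_iff)
    ultimately show ?thesis by simp
  next
    case False
    then have "exp (- 2 * \<bar>ln x\<bar>) = x\<^sup>2"
      using assms by (simp add: exp_of_nat_mult[of 2, simplified])
    then have "exp (- 2 * \<bar>ln x\<bar>) / x * (1 + x\<^sup>2) = x * (1 + x\<^sup>2)"
      using assms by (simp only:) (simp add: power2_eq_square)
    also have "\<dots> \<le> 1 * (1 + 1)"
      using False assms by (intro mult_mono add_mono power_le_one) auto
    finally show ?thesis by simp
  qed
  then show ?thesis using pos by (simp add: field_simps)
qed

text \<open>A parabola lies above its tangent of slope 2: expand (|l - m| - 2 s^2)^2 >= 0. The slope
  is the one required by \<open>exp_neg_2_abs_ln_le\<close>.\<close>

lemma exp_neg_square_le:
  fixes m s l R :: real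
  assumes "s > 0" "\<bar>m\<bar> \<le> R"
  shows "exp (- ((l - m)\<^sup>2 / (2 * s\<^sup>2))) \<le> exp (2 * R + 2 * s\<^sup>2) * exp (- 2 * \<bar>l\<bar>)"
proof -
  define q where "q = (l - m)\<^sup>2 / (2 * s\<^sup>2)"
  have "0 \<le> (\<bar>l - m\<bar> - 2 * s\<^sup>2)\<^sup>2 / (2 * s\<^sup>2)" by simp
  also have "\<dots> = q - 2 * \<bar>l - m\<bar> + 2 * s\<^sup>2"
    using assms(1) by (simp add: q_def field_simps power2_diff power2_eq_square)
  finally have "- q \<le> 2 * R + 2 * s\<^sup>2 + (- 2 * \<bar>l\<bar>)" using assms(2) by (auto simp: abs_if split: if_splits)
  then show ?thesis by (simp add: q_def flip: exp_add)
qed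

lemma lognormal_density_nonneg: "\<sigma> > 0 \<Longrightarrow> 0 \<le> lognormal_density \<mu> \<sigma> x"
  by (simp add: lognormal_density_def)

lemma borel_measurable_lognormal_density [measurable]:
  "lognormal_density \<mu> \<sigma> \<in> borel_measurable borel"
  unfolding lognormal_density_def by measurable

text \<open>The location parameter enters only through R, which gives a majorant that is locally
  uniform in \<open>Re w\<close>.\<close>

lemma lognormal_density_le:
  assumes "\<sigma> > 0" "\<bar>\<mu>\<bar> \<le> R"
  shows "lognormal_density \<mu> \<sigma> x
    \<le> 2 * exp (2 * R + 2 * \<sigma>\<^sup>2) / (sqrt (2 * pi) * \<sigma>) * inverse (1 + x\<^sup>2)"
proof (cases "x > 0")
  case True
  have "lognormal_density \<mu> \<sigma> x
      = 1 / (sqrt (2 * pi) * \<sigma>) * (exp (- ((ln x - \<mu>)\<^sup>2 / (2 * \<sigma>\<^sup>2))) / x)"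
    using True by (simp add: lognormal_density_def)
  also have "\<dots> \<le> 1 / (sqrt (2 * pi) * \<sigma>) * (exp (2 * R + 2 * \<sigma>\<^sup>2) * exp (- 2 * \<bar>ln x\<bar>) / x)"
    using True assms by (intro mult_left_mono divide_right_mono exp_neg_square_le) auto
  also have "\<dots> = exp (2 * R + 2 * \<sigma>\<^sup>2) / (sqrt (2 * pi) * \<sigma>) * (exp (- 2 * \<bar>ln x\<bar>) / x)"
    by simp
  also have "\<dots> \<le> exp (2 * R + 2 * \<sigma>\<^sup>2) / (sqrt (2 * pi) * \<sigma>) * (2 * inverse (1 + x\<^sup>2))"
    using True assms by (intro mult_left_mono exp_neg_2_abs_ln_le) auto
  finally show ?thesis by (simp add: mult_ac)
next
  case False
  then show ?thesis using assms(1) by (simp add: lognormal_density_def add_nonneg_nonneg)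
qed

lemma integrable_inverse_1_plus_square_lborel: "integrable lborel (\<lambda>x::real. inverse (1 + x\<^sup>2))"
  using integrable_inverse_1_plus_square by (simp add: set_integrable_def)

text \<open>Density form of the fact that r Y has law LN(\<mu> + ln r, \<sigma>^2) when Y has law
  LN(\<mu>, \<sigma>^2).\<close>

lemma lognormal_density_scale:
  assumes "r > 0"
  shows "r * lognormal_density (\<mu> + ln r) \<sigma> (r * x) = lognormal_density \<mu> \<sigma> x"
  using assms by (auto simp: lognormal_density_def ln_mult zero_less_mult_iff)

text \<open>The Laplace transform of \<open>LN(\<mu>, \<sigma>\<^sup>2)\<close> in the logarithmic variable \<open>w = ln z\<close>: rescaling the
  integration variable by \<open>z\<close> moves the dependence on \<open>z\<close> into the Gaussian factor, where \<open>ln z\<close>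
  may be replaced by any complex number.\<close>

definition log_laplace_integrand :: "real \<Rightarrow> real \<Rightarrow> complex \<Rightarrow> real \<Rightarrow> complex" where
  "log_laplace_integrand \<mu> \<sigma> w x =
     (if x > 0
      then of_real (exp (- x) / (sqrt (2 * pi) * \<sigma> * x)) *
        exp (- ((of_real (ln x - \<mu>) - w)\<^sup>2 / (2 * of_real (\<sigma>\<^sup>2))))
      else 0)"

definition log_laplace :: "real \<Rightarrow> real \<Rightarrow> complex \<Rightarrow> complex" where
  "log_laplace \<mu> \<sigma> w = (LINT x|lborel. log_laplace_integrand \<mu> \<sigma> w x)"

lemma borel_measurable_log_laplace_integrand [measurable]:
  "log_laplace_integrand \<mu> \<sigma> w \<in> borel_measurable borel"
  unfolding log_laplace_integrand_def by measurable

lemma log_laplace_integrand_of_real: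
  "log_laplace_integrand \<mu> \<sigma> (of_real a) x = of_real (lognormal_density (\<mu> + a) \<sigma> x * exp (- x))"
proof -
  have "exp (- ((of_real (ln x - \<mu>) - of_real a)\<^sup>2 / (2 * of_real (\<sigma>\<^sup>2))))
      = complex_of_real (exp (- ((ln x - (\<mu> + a))\<^sup>2 / (2 * \<sigma>\<^sup>2))))"
    by (simp add: diff_diff_eq flip: exp_of_real)
  then show ?thesis
    by (simp only: log_laplace_integrand_def lognormal_density_def) simp
qed

text \<open>The real part of (ln x - \<mu> - w)^2 is (ln x - \<mu> - Re w)^2 - (Im w)^2, so
  \<open>Im w\<close> contributes a factor independent of x.\<close>

lemma norm_log_laplace_integrand:
  assumes "\<sigma> > 0"
  shows "norm (log_laplace_integrand \<mu> \<sigma> w x)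
    = exp ((Im w)\<^sup>2 / (2 * \<sigma>\<^sup>2)) * (lognormal_density (\<mu> + Re w) \<sigma> x * exp (- x))"
proof (cases "x > 0")
  case True
  let ?u = "complex_of_real (ln x - \<mu>) - w"
  have "Re (- (?u\<^sup>2 / (2 * of_real (\<sigma>\<^sup>2)))) = - (Re (?u\<^sup>2) / (2 * \<sigma>\<^sup>2))"
    by (metis Re_divide_of_real minus_complex.sel(1) of_real_mult of_real_numeral uminus_complex.sel(1))
  also have "\<dots> = (Im w)\<^sup>2 / (2 * \<sigma>\<^sup>2) + - ((ln x - (\<mu> + Re w))\<^sup>2 / (2 * \<sigma>\<^sup>2))"
  proof -
    have "Re (?u\<^sup>2) = (ln x - (\<mu> + Re w))\<^sup>2 - (Im w)\<^sup>2"
      by (simp add: power2_eq_square algebra_simps)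
    then show ?thesis by (simp add: diff_divide_distrib)
  qed
  finally show ?thesis
    using True assms
    by (simp only: log_laplace_integrand_def lognormal_density_def if_True norm_mult norm_exp_eq_Re
        exp_add norm_of_real) simp
qed (simp add: log_laplace_integrand_def lognormal_density_def)

lemma holomorphic_log_laplace:
  assumes "\<sigma> > 0"
  shows "log_laplace \<mu> \<sigma> holomorphic_on UNIV"
  unfolding log_laplace_def
proof (rule holomorphic_on_lebesgue_integral)
  show "(\<lambda>z. log_laplace_integrand \<mu> \<sigma> z x) holomorphic_on UNIV" for x
    using assms by (cases "x > 0") (auto simp: log_laplace_integrand_def intro!: holomorphic_intros)
next
  fix z :: complex
  \<comment> \<open>For w in the unit ball about z, R bounds |\<mu> + Re w| and |Im z| + 1 bounds
    |Im w|; \<open>g\<close> combines the two resulting estimates.\<close>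
  define R where "R = \<bar>\<mu>\<bar> + \<bar>Re z\<bar> + 1"
  define g where "g x = exp ((\<bar>Im z\<bar> + 1)\<^sup>2 / (2 * \<sigma>\<^sup>2)) *
    (2 * exp (2 * R + 2 * \<sigma>\<^sup>2) / (sqrt (2 * pi) * \<sigma>) * inverse (1 + x\<^sup>2))" for x :: real
  have "norm (log_laplace_integrand \<mu> \<sigma> w x) \<le> g x" if "w \<in> ball z 1" for w x
  proof -
    have "\<bar>Re (z - w)\<bar> < 1" "\<bar>Im (z - w)\<bar> < 1"
      using that abs_Re_le_cmod[of "z - w"] abs_Im_le_cmod[of "z - w"] by (auto simp: dist_norm)
    then have w: "\<bar>\<mu> + Re w\<bar> \<le> R" "\<bar>Im w\<bar> \<le> \<bar>Im z\<bar> + 1"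
      by (auto simp: R_def)
    have "(Im w)\<^sup>2 \<le> (\<bar>Im z\<bar> + 1)\<^sup>2"
      using w(2) by (metis abs_ge_zero power2_abs power_mono)
    then have "exp ((Im w)\<^sup>2 / (2 * \<sigma>\<^sup>2)) \<le> exp ((\<bar>Im z\<bar> + 1)\<^sup>2 / (2 * \<sigma>\<^sup>2))"
      by (simp add: divide_right_mono)
    moreover have "lognormal_density (\<mu> + Re w) \<sigma> x * exp (- x) \<le>
        2 * exp (2 * R + 2 * \<sigma>\<^sup>2) / (sqrt (2 * pi) * \<sigma>) * inverse (1 + x\<^sup>2)"
    proof (cases "x > 0")
      case True
      then have "lognormal_density (\<mu> + Re w) \<sigma> x * exp (- x) \<le> lognormal_density (\<mu> + Re w) \<sigma> x * 1"
        using lognormal_density_nonneg[OF assms] by (intro mult_left_mono) auto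
      then show ?thesis using lognormal_density_le[OF assms w(1), of x] by linarith
    qed (use assms in \<open>simp add: lognormal_density_def add_nonneg_nonneg\<close>)
    ultimately show ?thesis
      unfolding norm_log_laplace_integrand[OF assms] g_def
      by (rule mult_mono) (simp_all add: lognormal_density_nonneg assms)
  qed
  moreover have "integrable lborel g"
    unfolding g_def using integrable_inverse_1_plus_square_lborel by simp
  ultimately show "\<exists>r>0. \<exists>g. ball z r \<subseteq> UNIV \<and> integrable lborel g \<and>
      (AE x in lborel. \<forall>w\<in>ball z r. norm (log_laplace_integrand \<mu> \<sigma> w x) \<le> g x)"
    by (intro exI[of _ 1] exI[of _ g]) auto
qed auto

text \<open>Reduces bounds and decay on horizontal strips to the real axis, where the integrand is
  nonnegative and the integral equals its own norm.\<close>

lemma norm_log_laplace_le: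
  assumes "\<sigma> > 0"
  shows "norm (log_laplace \<mu> \<sigma> w)
    \<le> exp ((Im w)\<^sup>2 / (2 * \<sigma>\<^sup>2)) * norm (log_laplace \<mu> \<sigma> (of_real (Re w)))"
proof -
  let ?d = "\<lambda>x. lognormal_density (\<mu> + Re w) \<sigma> x * exp (- x)"
  have "norm (log_laplace \<mu> \<sigma> w) \<le> (LINT x|lborel. norm (log_laplace_integrand \<mu> \<sigma> w x))"
    unfolding log_laplace_def by (rule integral_norm_bound)
  also have "\<dots> = exp ((Im w)\<^sup>2 / (2 * \<sigma>\<^sup>2)) * (LINT x|lborel. ?d x)"
    using assms by (simp add: norm_log_laplace_integrand)
  also have "(LINT x|lborel. ?d x) = norm (log_laplace \<mu> \<sigma> (of_real (Re w)))"
    unfolding log_laplace_def log_laplace_integrand_of_real integral_complex_of_real norm_of_real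
    using lognormal_density_nonneg[OF assms] by (intro abs_of_nonneg[symmetric] Bochner_Integration.integral_nonneg) simp
  finally show ?thesis .
qed

section \<open>Bounds and decay obtained from the real Laplace transform\<close>

lemma (in prob_space) lognormal_AE_pos:
  assumes "has_pdf M Y (lognormal_density \<mu> \<sigma>)"
  shows "AE \<omega> in M. Y \<omega> > 0"
proof -
  have "distributed M lborel Y (\<lambda>x. ennreal (lognormal_density \<mu> \<sigma> x))"
    using assms by (simp add: has_pdf_def)
  from distributed_AE2[OF this, of "\<lambda>x. x > 0"] show ?thesis
    by (auto simp: lognormal_density_def split: if_splits)
qed

text \<open>The substitution x -> r x needs r > 0 real; other arguments are reached later by the
  identity theorem.\<close>

lemma (in prob_space) log_laplace_ln:
  assumes "has_pdf M Y (lognormal_density \<mu> \<sigma>)" "r > 0"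
  shows "log_laplace \<mu> \<sigma> (of_real (ln r)) = of_real (expectation (\<lambda>\<omega>. exp (- r * Y \<omega>)))"
proof -
  have "(LINT x|lborel. lognormal_density (\<mu> + ln r) \<sigma> x * exp (- x))
      = (LINT x|lborel. (r * lognormal_density (\<mu> + ln r) \<sigma> (r * x)) * exp (- r * x))"
    using assms(2) by (subst lborel_integral_real_affine[where c = r and t = 0]) (auto simp: mult_ac)
  also have "\<dots> = (LINT x|lborel. lognormal_density \<mu> \<sigma> x * exp (- r * x))"
    using assms(2) by (simp add: lognormal_density_scale)
  also have "\<dots> = expectation (\<lambda>\<omega>. exp (- r * Y \<omega>))"
    using assms(1) by (intro distributed_integral) (auto simp: has_pdf_def)
  finally show ?thesis
    unfolding log_laplace_def log_laplace_integrand_of_real integral_complex_of_real by simp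
qed

text \<open>At the real point \<open>Re w\<close> the value is E[exp(-r Y)] with r = exp(Re w),
  which is at most 1 because Y > 0 almost surely.\<close>

lemma (in prob_space) norm_log_laplace_le_exp:
  assumes "has_pdf M Y (lognormal_density \<mu> \<sigma>)" "\<sigma> > 0"
  shows "norm (log_laplace \<mu> \<sigma> w) \<le> exp ((Im w)\<^sup>2 / (2 * \<sigma>\<^sup>2))"
proof -
  have [measurable]: "random_variable borel Y"
    using assms(1) by (auto simp: has_pdf_def distributed_def)
  have "norm (log_laplace \<mu> \<sigma> (of_real (Re w))) = \<bar>expectation (\<lambda>\<omega>. exp (- exp (Re w) * Y \<omega>))\<bar>"
    using log_laplace_ln[OF assms(1), of "exp (Re w)"] by simp
  also have "\<dots> \<le> 1"
  proof -
    have "expectation (\<lambda>\<omega>. exp (- exp (Re w) * Y \<omega>)) \<le> expectation (\<lambda>\<omega>. 1)"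
      by (rule integral_mono_AE') (use lognormal_AE_pos[OF assms(1)] in \<open>auto elim!: eventually_mono\<close>)
    moreover have "0 \<le> expectation (\<lambda>\<omega>. exp (- exp (Re w) * Y \<omega>))"
      by (intro Bochner_Integration.integral_nonneg) auto
    ultimately show ?thesis by (simp add: prob_space)
  qed
  finally have "norm (log_laplace \<mu> \<sigma> (of_real (Re w))) \<le> 1" .
  then have "exp ((Im w)\<^sup>2 / (2 * \<sigma>\<^sup>2)) * norm (log_laplace \<mu> \<sigma> (of_real (Re w)))
      \<le> exp ((Im w)\<^sup>2 / (2 * \<sigma>\<^sup>2)) * 1"
    by (intro mult_left_mono) auto
  from order_trans[OF norm_log_laplace_le[OF assms(2)] this] show ?thesis by simp
qed

lemma (in prob_space) log_laplace_tendsto_0: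
  assumes "has_pdf M Y (lognormal_density \<mu> \<sigma>)"
  shows "((\<lambda>r. log_laplace \<mu> \<sigma> (of_real (ln r))) \<longlongrightarrow> 0) at_top"
proof -
  have [measurable]: "random_variable borel Y"
    using assms(1) by (auto simp: has_pdf_def distributed_def)
  have "((\<lambda>r. expectation (\<lambda>\<omega>. exp (- r * Y \<omega>))) \<longlongrightarrow> expectation (\<lambda>\<omega>. 0)) at_top"
  proof (rule integral_dominated_convergence_at_top)
    show "AE \<omega> in M. ((\<lambda>r. exp (- r * Y \<omega>)) \<longlongrightarrow> 0) at_top"
      using lognormal_AE_pos[OF assms]
    proof eventually_elim
      case (elim \<omega>)
      then have "filterlim (\<lambda>r. - (Y \<omega> * r)) at_bot at_top"
        using filterlim_tendsto_pos_mult_at_top[OF tendsto_const elim filterlim_ident]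
        by (simp add: filterlim_uminus_at_top)
      then show ?case
        using filterlim_compose[OF exp_at_bot] by (simp add: mult.commute)
    qed
    show "\<forall>\<^sub>F r in at_top. AE \<omega> in M. norm (exp (- r * Y \<omega>)) \<le> 1"
      using eventually_ge_at_top[of 0]
    proof eventually_elim
      case (elim r)
      show ?case
        using lognormal_AE_pos[OF assms] by eventually_elim (use elim in auto)
    qed
  qed auto
  then have "((\<lambda>r. complex_of_real (expectation (\<lambda>\<omega>. exp (- r * Y \<omega>)))) \<longlongrightarrow> 0) at_top"
    using tendsto_of_real[where 'a = complex] by fastforce
  moreover have "\<forall>\<^sub>F r in at_top. complex_of_real (expectation (\<lambda>\<omega>. exp (- r * Y \<omega>)))
      = log_laplace \<mu> \<sigma> (of_real (ln r))"
    using eventually_gt_at_top[of 0] by eventually_elim (simp add: log_laplace_ln[OF assms])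
  ultimately show ?thesis by (rule Lim_transform_eventually)
qed

section \<open>Inversion on the quarter-plane\<close>

lemma norm_exp_i_le_1: "0 \<le> s \<Longrightarrow> 0 \<le> Im z \<Longrightarrow> norm (exp (\<i> * of_real s * z)) \<le> 1"
  by (simp add: mult_nonneg_nonneg)

text \<open>Mean value inequality in the exponent s between a and b, where the derivative \<i>z
  exp(\<i>sz) has norm at most |z|. The factor |z| cancels the 1/z of the inversion formula.\<close>

lemma norm_exp_i_diff_le:
  assumes "0 \<le> a" "a \<le> b" "0 \<le> Im z"
  shows "norm (exp (\<i> * of_real b * z) - exp (\<i> * of_real a * z)) \<le> (b - a) * norm z"
proof -
  have "norm ((\<lambda>s. exp (\<i> * s * z)) (of_real b) - (\<lambda>s. exp (\<i> * s * z)) (of_real a))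
      \<le> norm z * norm (complex_of_real b - of_real a)"
  proof (rule field_differentiable_bound[where S = "closed_segment (of_real a) (of_real b)"])
    fix s :: complex
    assume "s \<in> closed_segment (of_real a) (of_real b)"
    then obtain r where r: "s = of_real r" "r \<ge> 0"
      using assms by (auto simp: closed_segment_of_real closed_segment_eq_real_ivl)
    have "norm (exp (\<i> * s * z)) * norm z \<le> 1 * norm z"
      unfolding r using r(2) assms norm_exp_i_le_1 by (intro mult_right_mono) auto
    then show "norm (\<i> * z * exp (\<i> * s * z)) \<le> norm z"
      by (simp add: norm_mult mult.commute)
    show "((\<lambda>s. exp (\<i> * s * z)) has_field_derivative \<i> * z * exp (\<i> * s * z))
        (at s within closed_segment (of_real a) (of_real b))"
      by (auto intro!: derivative_eq_intros)
  qed auto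
  also have "norm (complex_of_real b - of_real a) = b - a"
    using assms(2) by (simp flip: of_real_diff)
  finally show ?thesis by (simp add: mult.commute)
qed

text \<open>The quarter-plane analogue of Jordan's lemma. The paths from \<open>x\<close> to \<open>\<i>x\<close> are straight segments,
  so that everything takes place in a convex domain and primitives replace contour integrals.\<close>

lemma rotate_integral_tendsto:
  fixes \<psi> :: "complex \<Rightarrow> complex" and a b C :: real
  defines "f \<equiv> \<lambda>z. \<psi> z * (exp (\<i> * of_real b * z) - exp (\<i> * of_real a * z)) / z"
  assumes ab: "0 \<le> a" "a \<le> b"
    and hol: "\<psi> holomorphic_on {z. Re z + Im z > 0}"
    and bounded: "\<And>z. Re z \<ge> 0 \<Longrightarrow> Im z \<ge> 0 \<Longrightarrow> z \<noteq> 0 \<Longrightarrow> norm (\<psi> z) \<le> C"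
    and decay: "\<And>e. e > 0 \<Longrightarrow> \<exists>R. \<forall>z. Re z \<ge> 0 \<longrightarrow> Im z \<ge> 0 \<longrightarrow> norm z \<ge> R \<longrightarrow> norm (\<psi> z) \<le> e"
  shows "(\<lambda>n. (LBINT t:{1/real (Suc n)..real (Suc n)}. f (of_real t)) -
              (LBINT t:{1/real (Suc n)..real (Suc n)}. \<i> * f (\<i> * of_real t))) \<longlonglongrightarrow> 0"
proof -
  \<comment> \<open>This open half-plane contains the closed first quadrant except 0, and it is
    convex, so \<open>f\<close> has a primitive \<open>F\<close> there.\<close>
  let ?H = "{z. Re z + Im z > 0}"
  have H_eq: "?H = {z. inner (Complex 1 1) z > 0}" by (simp add: inner_complex_def)
  have H: "open ?H" "convex ?H" unfolding H_eq by (rule open_halfspace_gt convex_halfspace_gt)+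
  have "f holomorphic_on ?H"
    unfolding f_def by (intro holomorphic_intros hol) auto
  then obtain F where "\<And>z. z \<in> ?H \<Longrightarrow> (F has_field_derivative f z) (at z within ?H)"
    using holomorphic_convex_primitive'[OF H(2,1)] by blast
  then have F: "(F has_field_derivative f z) (at z)" if "z \<in> ?H" for z
    using that H(1) at_within_open[of z ?H] by metis
  have cont: "continuous_on ?H f"
    using \<open>f holomorphic_on ?H\<close> by (rule holomorphic_on_imp_continuous_on)
  have real_axis: "(LBINT t:{x..y}. f (of_real t)) = F (of_real y) - F (of_real x)"
    if "0 < x" "x \<le> y" for x y :: real
    unfolding set_lebesgue_integral_def
  proof (rule integral_FTC_atLeastAtMost[OF that(2)])
    show "((\<lambda>t. F (of_real t)) has_vector_derivative f (of_real t)) (at t within {x..y})"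
      if "x \<le> t" "t \<le> y" for t
    proof -
      have "(of_real has_vector_derivative (1::complex)) (at t)"
        using has_vector_derivative_of_real[OF DERIV_ident, of "at t"] by simp
      from field_vector_diff_chain_at[OF this F] that \<open>0 < x\<close>
      have "((\<lambda>t. F (of_real t)) has_vector_derivative f (of_real t)) (at t)" by (simp add: o_def)
      then show ?thesis by (rule has_vector_derivative_at_within)
    qed
    show "continuous_on {x..y} (\<lambda>t. f (of_real t))"
      using that by (intro continuous_on_compose2[OF cont]) (auto intro!: continuous_intros)
  qed
  have imag_axis: "(LBINT t:{x..y}. \<i> * f (\<i> * of_real t)) = F (\<i> * of_real y) - F (\<i> * of_real x)"
    if "0 < x" "x \<le> y" for x y :: real
    unfolding set_lebesgue_integral_def
  proof (rule integral_FTC_atLeastAtMost[OF that(2)])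
    show "((\<lambda>t. F (\<i> * of_real t)) has_vector_derivative \<i> * f (\<i> * of_real t)) (at t within {x..y})"
      if "x \<le> t" "t \<le> y" for t
    proof -
      have "((\<lambda>t. \<i> * of_real t) has_vector_derivative \<i>) (at t)"
        using has_vector_derivative_mult_right[OF has_vector_derivative_of_real[OF DERIV_ident[of "at t"]], of \<i>]
        by simp
      from field_vector_diff_chain_at[OF this F] that \<open>0 < x\<close>
      have "((\<lambda>t. F (\<i> * of_real t)) has_vector_derivative \<i> * f (\<i> * of_real t)) (at t)"
        by (simp add: o_def)
      then show ?thesis by (rule has_vector_derivative_at_within)
    qed
    show "continuous_on {x..y} (\<lambda>t. \<i> * f (\<i> * of_real t))"
      using that by (intro continuous_on_mult continuous_on_const continuous_on_compose2[OF cont])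
        (auto intro!: continuous_intros)
  qed
  \<comment> \<open>The segment from x to \<i>x is the part of the line Re z + Im z = x in the
    quadrant; its length sqrt 2 * x is bounded by 2x.\<close>
  have chord: "norm (F (of_real x) - F (\<i> * of_real x)) \<le> B * (2 * x)"
    if "x > 0" and B: "\<And>z. Re z \<ge> 0 \<Longrightarrow> Im z \<ge> 0 \<Longrightarrow> Re z + Im z = x \<Longrightarrow> norm (f z) \<le> B" for x B
  proof -
    let ?S = "{z. Re z \<ge> 0 \<and> Im z \<ge> 0 \<and> Re z + Im z = x}"
    have "convex ?S"
    proof (rule convexI)
      fix y z and u v :: real
      assume *: "y \<in> ?S" "z \<in> ?S" "0 \<le> u" "0 \<le> v" "u + v = 1"
      then have "u * (Re y + Im y) + v * (Re z + Im z) = x"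
        by (simp flip: distrib_right)
      then have "(u * Re y + v * Re z) + (u * Im y + v * Im z) = x"
        by argo
      with * show "u *\<^sub>R y + v *\<^sub>R z \<in> ?S"
        by simp
    qed
    then have "norm (F (of_real x) - F (\<i> * of_real x)) \<le> B * norm (of_real x - \<i> * of_real x)"
      by (rule field_differentiable_bound[where f' = f])
        (use that in \<open>auto intro!: DERIV_subset[OF F]\<close>)
    also have "norm (of_real x - \<i> * of_real x) \<le> 2 * x"
      using norm_triangle_ineq4[of "of_real x" "\<i> * of_real x"] that(1) by (simp add: norm_mult)
    finally show ?thesis
      using B[of "of_real x"] that(1) by (simp add: mult_left_mono order_trans[OF norm_ge_zero])
  qed
  have Cnn: "C \<ge> 0" using bounded[of 1] norm_ge_zero[of "\<psi> 1"] by (simp, linarith)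
  have near: "norm (F (of_real x) - F (\<i> * of_real x)) \<le> C * (b - a) * (2 * x)" if "x > 0" for x
  proof (rule chord[OF that])
    fix z assume z: "Re z \<ge> 0" "Im z \<ge> 0" "Re z + Im z = x"
    then have "z \<noteq> 0" using that by auto
    have "norm (\<psi> z) * norm (exp (\<i> * of_real b * z) - exp (\<i> * of_real a * z)) \<le> C * ((b - a) * norm z)"
      using z \<open>z \<noteq> 0\<close> Cnn by (intro mult_mono bounded norm_exp_i_diff_le ab) auto
    then show "norm (f z) \<le> C * (b - a)"
      using \<open>z \<noteq> 0\<close> by (simp add: f_def norm_divide norm_mult divide_le_eq mult.assoc)
  qed
  \<comment> \<open>On the segment |z| >= x/2 and the two exponentials differ by at most 2, so |f|
    <= 2e / (x/2) = 4e/x; the length 2x gives 8e.\<close>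
  have far: "norm (F (of_real x) - F (\<i> * of_real x)) \<le> 8 * e"
    if "e > 0" "x > 0" and R: "\<forall>z. Re z \<ge> 0 \<longrightarrow> Im z \<ge> 0 \<longrightarrow> norm z \<ge> R \<longrightarrow> norm (\<psi> z) \<le> e"
      and x: "2 * R \<le> x" for x e R
  proof -
    have "norm (F (of_real x) - F (\<i> * of_real x)) \<le> 4 * e / x * (2 * x)"
    proof (rule chord[OF that(2)])
      fix z assume z: "Re z \<ge> 0" "Im z \<ge> 0" "Re z + Im z = x"
      then have "x / 2 \<le> norm z"
        using abs_Re_le_cmod[of z] abs_Im_le_cmod[of z] by linarith
      moreover have "norm (exp (\<i> * of_real b * z) - exp (\<i> * of_real a * z)) \<le> 2"
        using norm_exp_i_le_1[of b z] norm_exp_i_le_1[of a z] ab z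
          norm_triangle_ineq4[of "exp (\<i> * of_real b * z)" "exp (\<i> * of_real a * z)"] by linarith
      moreover have "norm (\<psi> z) \<le> e" using R z x \<open>x / 2 \<le> norm z\<close> by auto
      ultimately have "norm (f z) \<le> e * 2 / (x / 2)"
        unfolding f_def norm_divide norm_mult using that by (intro frac_le mult_mono) auto
      then show "norm (f z) \<le> 4 * e / x" by simp
    qed
    then show ?thesis using that(2) by simp
  qed
  have near_lim: "(\<lambda>n. F (of_real (1/real (Suc n))) - F (\<i> * of_real (1/real (Suc n)))) \<longlonglongrightarrow> 0"
  proof (rule Lim_null_comparison)
    show "\<forall>\<^sub>F n in sequentially. norm (F (of_real (1/real (Suc n))) - F (\<i> * of_real (1/real (Suc n))))
        \<le> C * (b - a) * (2 * (1/real (Suc n)))"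
      by (intro always_eventually allI near) auto
    show "(\<lambda>n. C * (b - a) * (2 * (1/real (Suc n)))) \<longlonglongrightarrow> 0"
      by (intro tendsto_mult_right_zero) (use LIMSEQ_inverse_real_of_nat in \<open>simp add: inverse_eq_divide\<close>)
  qed
  have far_lim: "(\<lambda>n. F (of_real (real (Suc n))) - F (\<i> * of_real (real (Suc n)))) \<longlonglongrightarrow> 0"
  proof (rule LIMSEQ_I)
    fix e :: real assume "e > 0"
    then obtain R where R: "\<forall>z. Re z \<ge> 0 \<longrightarrow> Im z \<ge> 0 \<longrightarrow> norm z \<ge> R \<longrightarrow> norm (\<psi> z) \<le> e / 16"
      using decay[of "e/16"] by auto
    obtain N where "2 * R \<le> real N" using real_arch_simple by blast
    then have "norm (F (of_real (real (Suc n))) - F (\<i> * of_real (real (Suc n)))) \<le> 8 * (e / 16)" if "n \<ge> N" for n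
      using that \<open>e > 0\<close> by (intro far[OF _ _ R]) auto
    then show "\<exists>N. \<forall>n\<ge>N. norm (F (of_real (real (Suc n))) - F (\<i> * of_real (real (Suc n))) - 0) < e"
      using \<open>e > 0\<close> by (intro exI[of _ N]) fastforce
  qed
  \<comment> \<open>The four differences of \<open>F\<close> run around the closed quadrilateral
    formed by the two axes and the two segments.\<close>
  have "(LBINT t:{1/real (Suc n)..real (Suc n)}. f (of_real t)) -
          (LBINT t:{1/real (Suc n)..real (Suc n)}. \<i> * f (\<i> * of_real t)) =
        (F (of_real (real (Suc n))) - F (\<i> * of_real (real (Suc n)))) -
        (F (of_real (1/real (Suc n))) - F (\<i> * of_real (1/real (Suc n))))" for n
    by (subst real_axis imag_axis; simp add: field_simps)+
  then show ?thesis using tendsto_diff[OF far_lim near_lim] by simp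
qed

text \<open>Factor out exp(-at) and use 1 + u <= exp u at u = -(b - a)t. The factor exp(-at) is kept
  because it makes the integral over the cut converge absolutely.\<close>

lemma norm_exp_diff_div_le:
  fixes a b t :: real
  assumes "a \<le> b" "0 < t"
  shows "\<bar>(exp (- (b * t)) - exp (- (a * t))) / t\<bar> \<le> (b - a) * exp (- (a * t))"
proof -
  have "1 + - ((b - a) * t) \<le> exp (- ((b - a) * t))"
    by (rule exp_ge_add_one_self)
  then have "exp (- (a * t)) * (1 - exp (- ((b - a) * t))) \<le> exp (- (a * t)) * ((b - a) * t)"
    by (intro mult_left_mono) auto
  then have "exp (- (a * t)) - exp (- (b * t)) \<le> (b - a) * exp (- (a * t)) * t"
    by (simp add: algebra_simps flip: exp_add)
  moreover have "exp (- (b * t)) \<le> exp (- (a * t))"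
    using assms by (simp add: mult_right_mono)
  ultimately show ?thesis
    using assms by (simp add: abs_le_iff divide_le_eq)
qed

lemma set_integrable_exp_neg:
  assumes "0 < (a::real)"
  shows "set_integrable lborel {0<..} (\<lambda>t. exp (- (a * t)))"
  using integrable_I0i_exp_mscale[OF assms] by (simp add: mult.commute)

text \<open>Levy's integrand takes conjugate values at t and -t, so the symmetric integral is twice
  a real part over the half-line. The negative half is the one kept: \<open>char M (- t)\<close> is
  the Laplace transform at \<i>t.\<close>

lemma (in real_distribution) Levy_inversion_half_line:
  fixes a b :: real and f :: "real \<Rightarrow> complex"
  assumes a: "0 \<le> a" "a \<le> b" and atoms: "measure M {a} = 0" "measure M {b} = 0"
    and f: "\<And>t. t > 0 \<Longrightarrow>
      f t = (exp (\<i> * of_real b * of_real t) - exp (\<i> * of_real a * of_real t)) / of_real t * char M (- t)"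
  shows "(\<lambda>n. 1 / pi * Im (LBINT t:{0<..real n}. f t)) \<longlonglongrightarrow> measure M {a<..b}"
proof -
  define K where "K t = (iexp (- (t * a)) - iexp (- (t * b))) / (\<i> * of_real t) * char M t" for t :: real
  have [measurable]: "K \<in> borel_measurable borel"
    unfolding K_def by measurable
  have cnj_char: "cnj (char M t) = char M (- t)" for t
    unfolding char_def by (subst Bochner_Integration.integral_cnj[symmetric]) (simp add: exp_cnj)
  have K_neg: "K (- t) = cnj (K t)" for t
    unfolding K_def by (simp add: exp_cnj cnj_char)
  have K_f: "K (- t) = - \<i> * f t" if "t > 0" for t
    unfolding K_def f[OF that] using that by (simp add: field_simps)
  have K_bound: "norm (K t) \<le> b - a" for t
  proof -
    have "norm ((iexp (- (t * a)) - iexp (- (t * b))) / (\<i> * of_real t)) \<le> b - a"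
    proof -
      have "norm (iexp (- (t * a)) - iexp (- (t * b))) \<le> (b - a) * \<bar>t\<bar>"
        using norm_exp_i_diff_le[OF a, of "- of_real t"]
        by (simp add: norm_minus_commute mult_ac)
      then show ?thesis
        using a by (simp add: norm_divide norm_mult divide_le_eq)
    qed
    then have "norm ((iexp (- (t * a)) - iexp (- (t * b))) / (\<i> * of_real t)) * norm (char M t) \<le> (b - a) * 1"
      using cmod_char_le_1 a by (intro mult_mono) auto
    then show ?thesis by (simp only: K_def norm_mult mult_1_right)
  qed
  have K_int: "set_integrable lborel {x..y} K" for x y
    unfolding set_integrable_def
  proof (rule Bochner_Integration.integrable_bound)
    show "integrable lborel (\<lambda>t. (b - a) * indicator {x..y} t)"
      by (intro integrable_mult_right integrable_real_indicator) (auto simp: emeasure_lborel_Icc_eq)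
    show "AE t in lborel. norm (indicat_real {x..y} t *\<^sub>R K t) \<le> norm ((b - a) * indicat_real {x..y} t)"
      using K_bound a by (auto split: split_indicator)
  qed measurable
  have "1 / (2 * pi) * (CLBINT t=-real n..real n. K t) = of_real (1 / pi * Im (LBINT t:{0<..real n}. f t))" for n :: nat
  proof -
    have "(CLBINT t=-real n..real n. K t) = (LBINT t:{- real n..real n}. K t)"
      by (subst interval_integral_Icc[symmetric]) auto
    also have "\<dots> = (LBINT t:{- real n..0}. K t) + (LBINT t:{0..real n}. K t)"
    proof -
      have "{- real n..real n} = {- real n..0} \<union> {0..real n}" by auto
      moreover have "AE t in lborel. t \<noteq> (0::real)" by (rule AE_lborel_singleton)
      ultimately show ?thesis
        by (simp only:) (rule set_integral_Un_AE, auto intro: K_int elim!: eventually_mono)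
    qed
    also have "(LBINT t:{- real n..0}. K t) = (LBINT t:{0..real n}. K (- t))"
      unfolding set_lebesgue_integral_def
      by (subst lborel_integral_real_affine[where c = "-1" and t = 0])
        (auto intro!: Bochner_Integration.integral_cong split: split_indicator)
    also have "(LBINT t:{0..real n}. K t) = cnj (LBINT t:{0..real n}. K (- t))"
      unfolding set_lebesgue_integral_def
      by (simp add: K_neg flip: Bochner_Integration.integral_cnj)
    also have "(LBINT t:{0..real n}. K (- t)) = (LBINT t:{0<..real n}. - \<i> * f t)"
    proof -
      \<comment> \<open>\<open>f\<close> is prescribed for t > 0 only; the endpoint 0 is a null
        set.\<close>
      have "AE t in lborel. t \<noteq> (0::real)" by (rule AE_lborel_singleton)
      then have "AE t in lborel. indicat_real {0..real n} t *\<^sub>R K (- t) = indicat_real {0<..real n} t *\<^sub>R (- \<i> * f t)"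
        by eventually_elim (auto simp: K_f split: split_indicator)
      moreover have "(\<lambda>t. indicat_real {0<..real n} t *\<^sub>R (- \<i> * f t)) \<in> borel_measurable borel"
      proof -
        \<comment> \<open>Measurability of \<open>f\<close> on the half-open interval is inherited
          from \<open>K\<close>.\<close>
        have "(\<lambda>t. indicat_real {0<..real n} t *\<^sub>R (- \<i> * f t)) = (\<lambda>t. indicat_real {0<..real n} t *\<^sub>R K (- t))"
          by (auto simp: K_f split: split_indicator)
        then show ?thesis by simp
      qed
      ultimately show ?thesis
        unfolding set_lebesgue_integral_def by (intro integral_cong_AE) auto
    qed
    also have "\<dots> = - \<i> * (LBINT t:{0<..real n}. f t)"
      by (rule set_integral_mult_right)
    \<comment> \<open>With J the half-line integral of \<open>f\<close>, -\<i>J plus its conjugate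
      is 2 Im J, which turns 1/(2\<pi>) into 1/\<pi>.\<close>
    finally show ?thesis by (simp add: complex_eq_iff)
  qed
  moreover have "(\<lambda>n. 1 / (2 * pi) * (CLBINT t=-real n..real n. K t)) \<longlonglongrightarrow> of_real (measure M {a<..b})"
    unfolding K_def using Levy_Inversion[OF a(2) atoms] by simp
  ultimately show ?thesis
    by (simp only: tendsto_of_real_iff)
qed

text \<open>The hypotheses on \<open>\<psi>\<close> are those satisfied by \<open>\<zeta> \<mapsto> \<phi>(\<i>\<zeta>)\<close>, so that the two edges of the
  quarter-plane are the positive imaginary axis and the upper side of the cut of \<open>\<phi>\<close>.\<close>

locale quarter_plane_char = real_distribution M for M :: "real measure" +
  fixes \<psi> :: "complex \<Rightarrow> complex" and C :: real
  assumes no_atoms: "\<And>x. measure M {x} = 0"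
    and holomorphic: "\<psi> holomorphic_on {z. Re z + Im z > 0}"
    and bounded: "\<And>z. Re z \<ge> 0 \<Longrightarrow> Im z \<ge> 0 \<Longrightarrow> z \<noteq> 0 \<Longrightarrow> norm (\<psi> z) \<le> C"
    and decay: "\<And>e. e > 0 \<Longrightarrow> \<exists>R. \<forall>z. Re z \<ge> 0 \<longrightarrow> Im z \<ge> 0 \<longrightarrow> norm z \<ge> R \<longrightarrow> norm (\<psi> z) \<le> e"
    and char_eq: "\<And>t. t > 0 \<Longrightarrow> \<psi> (of_real t) = char M (- t)"
begin

text \<open>For t > 0 the point \<i>t corresponds to -t on the upper side of the cut of \<phi>. The
  default 0 elsewhere makes the function bounded and measurable on the whole line.\<close>

definition cut :: "real \<Rightarrow> real" where
  "cut t = (if t > 0 then Im (\<psi> (\<i> * of_real t)) else 0)"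

definition pdf :: "real \<Rightarrow> real" where
  "pdf x = - (1 / pi) * (LBINT t:{0<..}. cut t * exp (- t * x))"

lemma C_nonneg: "0 \<le> C"
  using bounded[of 1] norm_ge_zero[of "\<psi> 1"] by (simp, linarith)

lemma abs_cut_le: "\<bar>cut t\<bar> \<le> C"
  using bounded[of "\<i> * of_real t"] abs_Im_le_cmod[of "\<psi> (\<i> * of_real t)"] C_nonneg
  by (auto simp: cut_def)

lemma continuous_on_psi: "continuous_on {z. Re z + Im z > 0} \<psi>"
  using holomorphic by (rule holomorphic_on_imp_continuous_on)

lemma borel_measurable_cut [measurable]: "cut \<in> borel_measurable borel"
proof -
  have "continuous_on {0<..} (\<lambda>t. Im (\<psi> (\<i> * of_real t)))"
    by (intro continuous_on_Im continuous_on_compose2[OF continuous_on_psi]) (auto intro!: continuous_intros)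
  from borel_measurable_continuous_on_indicator[OF _ this]
  have "(\<lambda>t. indicat_real {0<..} t *\<^sub>R Im (\<psi> (\<i> * of_real t))) \<in> borel_measurable borel"
    by simp
  also have "(\<lambda>t. indicat_real {0<..} t *\<^sub>R Im (\<psi> (\<i> * of_real t))) = cut"
    by (auto simp: cut_def)
  finally show ?thesis .
qed

lemma set_integrable_cut_exp:
  assumes "x > 0"
  shows "set_integrable lborel {0<..} (\<lambda>t. cut t * exp (- t * x))"
proof (rule set_integrable_bound)
  show "set_integrable lborel {0<..} (\<lambda>t. C * exp (- (x * t)))"
    using set_integrable_exp_neg[OF assms] by simp
  show "set_borel_measurable lborel {0<..} (\<lambda>t. cut t * exp (- t * x))"
    unfolding set_borel_measurable_def by measurable
  show "AE t in lborel. t \<in> {0<..} \<longrightarrow> norm (cut t * exp (- t * x)) \<le> norm (C * exp (- (x * t)))"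
    using abs_cut_le C_nonneg by (auto simp: abs_mult mult.commute intro!: mult_left_mono)
qed

text \<open>After rotation the exponentials are real, so taking the imaginary part in the half-line
  formula affects only \<open>\<psi>\<close>.\<close>

lemma measure_Ioc_eq_integral_cut:
  assumes "0 < a" "a \<le> b"
  shows "measure M {a<..b} = 1 / pi * (LBINT t:{0<..}. cut t * ((exp (- (b * t)) - exp (- (a * t))) / t))"
proof -
  define f where "f z = \<psi> z * (exp (\<i> * of_real b * z) - exp (\<i> * of_real a * z)) / z" for z
  define p where "p t = \<psi> (\<i> * of_real t) * of_real ((exp (- (b * t)) - exp (- (a * t))) / t)" for t
  have f_imag: "\<i> * f (\<i> * of_real t) = p t" for t
  proof -
    have "exp (\<i> * of_real s * (\<i> * of_real t)) = complex_of_real (exp (- (s * t)))" for s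
      by (simp add: exp_of_real[symmetric] mult_ac)
    then show ?thesis by (simp add: f_def p_def)
  qed
  have f_bound: "norm (f z) \<le> C * (b - a)" if z: "Re z \<ge> 0" "Im z \<ge> 0" "z \<noteq> 0" for z
  proof -
    have "norm (\<psi> z) * norm (exp (\<i> * of_real b * z) - exp (\<i> * of_real a * z)) \<le> C * ((b - a) * norm z)"
      using z assms C_nonneg by (intro mult_mono bounded norm_exp_i_diff_le) auto
    then show ?thesis
      using z by (simp add: f_def norm_divide norm_mult divide_le_eq mult.assoc)
  qed
  have p_bound: "norm (p t) \<le> C * ((b - a) * exp (- (a * t)))" if "t > 0" for t
    unfolding p_def norm_mult norm_of_real
    using that assms C_nonneg by (intro mult_mono bounded norm_exp_diff_div_le) auto
  have p_meas: "set_borel_measurable lborel {0<..} p"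
  proof -
    have "continuous_on {0<..} p"
      unfolding p_def
      by (intro continuous_intros continuous_on_compose2[OF continuous_on_psi]) auto
    from borel_measurable_continuous_on_indicator[OF _ this] show ?thesis
      by (simp add: set_borel_measurable_def)
  qed
  have p_int: "set_integrable lborel {0<..} p"
  proof (rule set_integrable_bound[OF _ p_meas])
    show "set_integrable lborel {0<..} (\<lambda>t. C * ((b - a) * exp (- (a * t))))"
      using set_integrable_exp_neg[OF assms(1)] by simp
    show "AE t in lborel. t \<in> {0<..} \<longrightarrow> norm (p t) \<le> norm (C * ((b - a) * exp (- (a * t))))"
      using p_bound C_nonneg assms by (auto simp: abs_mult)
  qed
  have f_meas: "set_borel_measurable lborel {0<..} (\<lambda>t. f (of_real t))"
  proof -
    have "continuous_on {0<..} (\<lambda>t. f (of_real t))"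
      unfolding f_def
      by (intro continuous_intros continuous_on_compose2[OF continuous_on_psi]) auto
    from borel_measurable_continuous_on_indicator[OF _ this] show ?thesis
      by (simp add: set_borel_measurable_def)
  qed
  have f_int: "set_integrable lborel {0<..x} (\<lambda>t. f (of_real t))" for x
  proof (rule set_integrable_bound)
    show "set_integrable lborel {0<..x} (\<lambda>t. C * (b - a))"
      unfolding set_integrable_def
      by (cases "0 \<le> x") (auto intro!: integrable_real_indicator)
    show "set_borel_measurable lborel {0<..x} (\<lambda>t. f (of_real t))"
      using f_meas by (rule set_borel_measurable_subset) auto
    show "AE t in lborel. t \<in> {0<..x} \<longrightarrow> norm (f (of_real t)) \<le> norm (C * (b - a))"
      using f_bound C_nonneg assms by (auto simp: abs_mult)
  qed
  \<comment> \<open>\<open>Suc n\<close> keeps the lower end positive and defined, and not above the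
    upper end, also for n = 0.\<close>
  let ?I = "\<lambda>n. {1/real (Suc n)..real (Suc n)}"
  have I_pos: "0 < t" if "t \<in> ?I n" for t n
    using that less_le_trans[of 0 "1 / real (Suc n)" t] by (simp del: of_nat_Suc)
  have rot: "(\<lambda>n. (LBINT t:?I n. f (of_real t)) - (LBINT t:?I n. p t)) \<longlonglongrightarrow> 0"
    unfolding f_imag[symmetric] f_def
    by (rule rotate_integral_tendsto[OF less_imp_le[OF assms(1)] assms(2) holomorphic])
      (erule (2) bounded, erule decay)
  \<comment> \<open>Levy's integral starts at 0 but the rotated one at 1/(n+1); since |f| <= C(b -
    a), the missing piece vanishes in the limit.\<close>
  have "(\<lambda>n. (LBINT t:{0<..real (Suc n)}. f (of_real t)) - (LBINT t:?I n. f (of_real t))) \<longlonglongrightarrow> 0"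
  proof (rule Lim_null_comparison)
    have "norm ((LBINT t:{0<..real (Suc n)}. f (of_real t)) - (LBINT t:?I n. f (of_real t)))
        \<le> C * (b - a) * (1 / real (Suc n))" for n
    proof -
      have *: "{0<..real (Suc n)} = {0<..<1/real (Suc n)} \<union> ?I n"
      proof -
        have "{0<..u} = {0<..<l} \<union> {l..u}" if "0 < l" "l \<le> u" for l u :: real
          using that by auto
        moreover have "1 / real (Suc n) \<le> real (Suc n)"
          by (rule order_trans[of _ 1]) auto
        ultimately show ?thesis by simp
      qed
      have int: "set_integrable lborel {0<..<1/real (Suc n)} (\<lambda>t. f (of_real t))"
          "set_integrable lborel (?I n) (\<lambda>t. f (of_real t))"
        by (rule set_integrable_subset[OF f_int[of "real (Suc n)"]], simp, unfold *, blast)+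
      have "(LBINT t:{0<..real (Suc n)}. f (of_real t)) - (LBINT t:?I n. f (of_real t))
          = (LBINT t:{0<..<1/real (Suc n)}. f (of_real t))"
        unfolding * by (subst set_integral_Un[OF _ int]) auto
      also have "norm \<dots> \<le> (LBINT t:{0<..<1/real (Suc n)}. C * (b - a))"
        unfolding set_lebesgue_integral_def
      proof (rule order_trans[OF integral_norm_bound], rule integral_mono)
        show "integrable lborel (\<lambda>t. norm (indicat_real {0<..<1 / real (Suc n)} t *\<^sub>R f (of_real t)))"
          by (rule integrable_norm[OF int(1)[unfolded set_integrable_def]])
        show "integrable lborel (\<lambda>t. indicat_real {0<..<1 / real (Suc n)} t *\<^sub>R (C * (b - a)))"
          by (auto intro!: integrable_real_indicator)
      qed (use f_bound in \<open>auto split: split_indicator\<close>)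
      also have "\<dots> = C * (b - a) * (1 / real (Suc n))"
        by (simp add: set_lebesgue_integral_def)
      finally show ?thesis .
    qed
    then show "\<forall>\<^sub>F n in sequentially.
        norm ((LBINT t:{0<..real (Suc n)}. f (of_real t)) - (LBINT t:?I n. f (of_real t)))
          \<le> C * (b - a) * (1 / real (Suc n))" by simp
    show "(\<lambda>n. C * (b - a) * (1 / real (Suc n))) \<longlonglongrightarrow> 0"
      by (intro tendsto_mult_right_zero) (use LIMSEQ_inverse_real_of_nat in \<open>simp add: inverse_eq_divide\<close>)
  qed
  \<comment> \<open>On the cut the truncation can be removed by dominated convergence, because
    \<open>p\<close> is absolutely integrable.\<close>
  moreover have "(\<lambda>n. LBINT t:?I n. p t) \<longlonglongrightarrow> (LBINT t:{0<..}. p t)"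
    unfolding set_lebesgue_integral_def
  proof (rule integral_dominated_convergence)
    show "integrable lborel (\<lambda>t. norm (indicat_real {0<..} t *\<^sub>R p t))"
      by (rule integrable_norm[OF p_int[unfolded set_integrable_def]])
    show "(\<lambda>t. indicat_real {0<..} t *\<^sub>R p t) \<in> borel_measurable lborel"
      using p_meas by (simp add: set_borel_measurable_def)
    show "(\<lambda>t. indicat_real (?I n) t *\<^sub>R p t) \<in> borel_measurable lborel" for n
    proof -
      have "?I n \<subseteq> {0<..}" using I_pos by (simp add: subset_iff)
      with p_meas have "set_borel_measurable lborel (?I n) p"
        by (intro set_borel_measurable_subset[OF p_meas]) auto
      then show ?thesis by (simp add: set_borel_measurable_def)
    qed
    show "AE t in lborel. norm (indicat_real (?I n) t *\<^sub>R p t) \<le> norm (indicat_real {0<..} t *\<^sub>R p t)" for n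
    proof (rule AE_I2)
      show "norm (indicat_real (?I n) t *\<^sub>R p t) \<le> norm (indicat_real {0<..} t *\<^sub>R p t)" for t
        using I_pos[of t n] by (cases "t \<in> ?I n") (simp_all del: atLeastAtMost_iff of_nat_Suc)
    qed
    show "AE t in lborel. (\<lambda>n. indicat_real (?I n) t *\<^sub>R p t) \<longlonglongrightarrow> indicat_real {0<..} t *\<^sub>R p t"
    proof (rule AE_I2)
      fix t :: real
      have "\<forall>\<^sub>F n in sequentially. indicat_real {0<..} t *\<^sub>R p t = indicat_real (?I n) t *\<^sub>R p t"
      proof (cases "t > 0")
        case True
        obtain N where N: "t \<le> real N" "1 / t \<le> real N"
          using real_arch_simple[of "max t (1/t)"] by auto
        have "t \<in> ?I n" if "n \<ge> N" for n
        proof -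
          have "t \<le> real (Suc n)" "1 / t \<le> real (Suc n)" using N that by linarith+
          then show ?thesis using True by (simp add: field_simps)
        qed
        then show ?thesis using True by (auto simp: eventually_sequentially intro!: exI[of _ N])
      next
        case False
        then have "t \<notin> ?I n" for n
          using I_pos by blast
        with False show ?thesis by (simp del: atLeastAtMost_iff of_nat_Suc)
      qed
      then show "(\<lambda>n. indicat_real (?I n) t *\<^sub>R p t) \<longlonglongrightarrow> indicat_real {0<..} t *\<^sub>R p t"
        by (rule Lim_transform_eventually[OF tendsto_const])
    qed
  qed
  ultimately have "(\<lambda>n. LBINT t:{0<..real (Suc n)}. f (of_real t)) \<longlonglongrightarrow> (LBINT t:{0<..}. p t)"
    using tendsto_add[OF rot] by (fastforce dest: tendsto_add)
  then have "(\<lambda>n. 1 / pi * Im (LBINT t:{0<..real (Suc n)}. f (of_real t)))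
      \<longlonglongrightarrow> 1 / pi * Im (LBINT t:{0<..}. p t)"
    by (intro tendsto_intros)
  \<comment> \<open>The index is shifted by one to match the truncations at
    \<open>Suc n\<close>.\<close>
  moreover have "(\<lambda>n. 1 / pi * Im (LBINT t:{0<..real (Suc n)}. f (of_real t))) \<longlonglongrightarrow> measure M {a<..b}"
    using LIMSEQ_Suc[OF Levy_inversion_half_line[OF less_imp_le[OF assms(1)] assms(2) no_atoms no_atoms,
          of "\<lambda>t. f (of_real t)"]]
    by (simp add: f_def char_eq)
  ultimately have "measure M {a<..b} = 1 / pi * Im (LBINT t:{0<..}. p t)"
    using LIMSEQ_unique by blast
  also have "Im (LBINT t:{0<..}. p t) = (LBINT t:{0<..}. Im (p t))"
    using p_int by (simp add: set_lebesgue_integral_def set_integrable_def integral_Im[symmetric])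
  also have "\<dots> = (LBINT t:{0<..}. cut t * ((exp (- (b * t)) - exp (- (a * t))) / t))"
    by (intro set_lebesgue_integral_cong) (auto simp: cut_def p_def)
  finally show ?thesis .
qed

end

section \<open>From interval probabilities to a density\<close>

lemma LBINT_exp_neg:
  fixes a b t :: real
  assumes "a \<le> b" "t \<noteq> 0"
  shows "(LBINT x:{a..b}. exp (- t * x)) = (exp (- (a * t)) - exp (- (b * t))) / t"
proof -
  have "(LBINT x:{a..b}. exp (- t * x)) = - exp (- t * b) / t - - exp (- t * a) / t"
    unfolding set_lebesgue_integral_def
  proof (rule integral_FTC_atLeastAtMost[OF assms(1)])
    show "((\<lambda>x. - exp (- t * x) / t) has_vector_derivative exp (- t * x)) (at x within {a..b})" for x
      unfolding has_real_derivative_iff_has_vector_derivative[symmetric]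
      using assms(2) by (auto intro!: derivative_eq_intros)
  qed (intro continuous_intros)
  then show ?thesis by (simp add: diff_divide_distrib mult.commute)
qed

context quarter_plane_char
begin

lemma borel_measurable_pdf [measurable]: "pdf \<in> borel_measurable borel"
  unfolding pdf_def[abs_def] set_lebesgue_integral_def by measurable

text \<open>Up to a constant, \<open>pdf\<close> is the Laplace transform of the bounded function
  \<open>cut\<close>; it extends holomorphically to the right half-plane by the parameter lemma, and
  continuity follows by restriction.\<close>

lemma continuous_on_pdf: "continuous_on {0<..} pdf"
proof -
  let ?S = "{z. Re z > 0}"
  let ?f = "\<lambda>z t. complex_of_real (indicat_real {0<..} t * cut t) * exp (- of_real t * z)"
  let ?F = "\<lambda>z. LINT t|lborel. ?f z t"
  have "?F holomorphic_on ?S"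
  proof (rule holomorphic_on_lebesgue_integral)
    show "open ?S" by (rule open_halfspace_Re_gt)
    fix z assume "z \<in> ?S"
    then have z: "Re z > 0" by simp
    have sub: "Re w \<ge> Re z / 2" if "w \<in> ball z (Re z / 2)" for w
      using that abs_Re_le_cmod[of "z - w"] by (auto simp: dist_norm)
    define g where "g t = indicat_real {0<..} t *\<^sub>R (C * exp (- (Re z / 2 * t)))" for t
    have "integrable lborel g"
      using set_integrable_exp_neg[of "Re z / 2"] z unfolding g_def set_integrable_def
      by (simp only: mult_scaleR_right[symmetric]) (intro integrable_mult_right, simp)
    moreover have "norm (?f w t) \<le> g t" if w: "w \<in> ball z (Re z / 2)" for w t
    proof (cases "t > 0")
      case True
      have "\<bar>cut t\<bar> * exp (- (t * Re w)) \<le> C * exp (- (Re z / 2 * t))"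
        using True sub[OF w] abs_cut_le C_nonneg by (intro mult_mono) (auto simp: mult.commute)
      then show ?thesis using True by (simp add: norm_mult g_def)
    qed (simp add: g_def)
    moreover have "ball z (Re z / 2) \<subseteq> ?S"
      using sub z by force
    ultimately show "\<exists>r>0. \<exists>g. ball z r \<subseteq> ?S \<and> integrable lborel g \<and>
        (AE t in lborel. \<forall>w\<in>ball z r. norm (?f w t) \<le> g t)"
      using z by (intro exI[of _ "Re z / 2"] exI[of _ g]) auto
  qed (auto intro!: holomorphic_intros)
  moreover define F where "F = ?F"
  ultimately have "continuous_on ?S F"
    by (simp only: holomorphic_on_imp_continuous_on)
  then have "continuous_on {0<..} (\<lambda>x. F (of_real x))"
    by (rule continuous_on_compose2) (auto intro: continuous_on_of_real_id)
  then have "continuous_on {0<..} (\<lambda>x. - (1 / pi) * Re (F (of_real x)))"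
    by (intro continuous_on_mult continuous_on_const continuous_on_Re)
  moreover have "F (of_real x) = of_real (LBINT t:{0<..}. cut t * exp (- t * x))" for x
    unfolding F_def set_lebesgue_integral_def integral_complex_of_real[symmetric]
    by (intro Bochner_Integration.integral_cong) (auto simp: exp_of_real[symmetric])
  ultimately show ?thesis by (simp add: pdf_def[abs_def])
qed

lemma set_integrable_pdf: "0 < a \<Longrightarrow> set_integrable lborel {a..b} pdf"
  by (intro borel_integrable_atLeastAtMost' continuous_on_subset[OF continuous_on_pdf]) auto

text \<open>The quotient of exponentials in \<open>measure_Ioc_eq_integral_cut\<close> is minus the
  integral of exp(-tx) over x from a to b. Fubini applies since x >= a bounds the double integrand
  by C exp(-at).\<close>

lemma measure_Ioc_eq_integral_pdf:
  assumes "0 < a" "a \<le> b"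
  shows "measure M {a<..b} = (LBINT x:{a..b}. pdf x)"
proof -
  define h where "h t x = indicat_real {a..b} x * (indicat_real {0<..} t * (cut t * exp (- t * x)))" for t x
  have [measurable]: "case_prod h \<in> borel_measurable (lborel \<Otimes>\<^sub>M lborel)"
    unfolding h_def case_prod_beta by measurable
  have h_bound: "\<bar>h t x\<bar> \<le> indicat_real {a..b} x * (indicat_real {0<..} t * (C * exp (- (a * t))))" for t x
  proof (cases "a \<le> x \<and> 0 < t")
    case True
    then have "\<bar>cut t\<bar> * exp (- (t * x)) \<le> C * exp (- (a * t))"
      using abs_cut_le C_nonneg by (intro mult_mono) auto
    with True show ?thesis by (auto simp: h_def abs_mult split: split_indicator)
  qed (auto simp: h_def)
  have exp_int: "integrable lborel (\<lambda>t. indicat_real {0<..} t * (C * exp (- (a * t))))"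
    using set_integrable_exp_neg[OF assms(1)] unfolding set_integrable_def
    by (simp add: mult.left_commute)
  have h_row: "integrable lborel (h t)" for t
  proof (rule Bochner_Integration.integrable_bound)
    show "integrable lborel (\<lambda>x. indicat_real {a..b} x * (indicat_real {0<..} t * (C * exp (- (a * t)))))"
      by (intro integrable_mult_left integrable_real_indicator) (auto simp: emeasure_lborel_Icc_eq)
    show "h t \<in> borel_measurable lborel" unfolding h_def by measurable
  qed (use h_bound[of t] C_nonneg in \<open>auto simp: abs_mult\<close>)
  have "integrable (lborel \<Otimes>\<^sub>M lborel) (case_prod h)"
  proof (rule lborel_pair.Fubini_integrable)
    show "integrable lborel (\<lambda>t. LINT x|lborel. norm (case_prod h (t, x)))"
    proof (rule Bochner_Integration.integrable_bound)
      show "integrable lborel (\<lambda>t. (b - a) * (indicat_real {0<..} t * (C * exp (- (a * t)))))"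
        using exp_int by simp
      have "(LINT x|lborel. \<bar>h t x\<bar>) \<le> (b - a) * (indicat_real {0<..} t * (C * exp (- (a * t))))" for t
      proof -
        have "(LINT x|lborel. \<bar>h t x\<bar>) \<le>
            (LINT x|lborel. indicat_real {a..b} x * (indicat_real {0<..} t * (C * exp (- (a * t)))))"
          using h_row[of t] h_bound[of t]
          by (intro integral_mono integrable_mult_left integrable_real_indicator)
            (auto simp: emeasure_lborel_Icc_eq)
        also have "\<dots> = (b - a) * (indicat_real {0<..} t * (C * exp (- (a * t))))"
          using assms by simp
        finally show ?thesis .
      qed
      then show "AE t in lborel. norm (LINT x|lborel. norm (case_prod h (t, x))) \<le>
          norm ((b - a) * (indicat_real {0<..} t * (C * exp (- (a * t)))))"
        by (intro AE_I2) (auto intro: order_trans[OF _ abs_ge_self])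
    qed measurable
    show "AE t in lborel. integrable lborel (\<lambda>x. case_prod h (t, x))"
      using h_row by simp
  qed measurable
  then have "(LINT x|lborel. LINT t|lborel. h t x) = (LINT t|lborel. LINT x|lborel. h t x)"
    by (rule lborel_pair.Fubini_integral)
  also have "(\<lambda>t. LINT x|lborel. h t x)
      = (\<lambda>t. - (indicat_real {0<..} t * (cut t * ((exp (- (b * t)) - exp (- (a * t))) / t))))"
  proof
    fix t :: real
    have "(LINT x|lborel. h t x) = (indicat_real {0<..} t * cut t) * (LBINT x:{a..b}. exp (- t * x))"
    proof -
      have "h t = (\<lambda>x. (indicat_real {0<..} t * cut t) * (indicat_real {a..b} x *\<^sub>R exp (- t * x)))"
        by (simp add: h_def fun_eq_iff mult_ac)
      then show ?thesis
        unfolding set_lebesgue_integral_def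
        by (simp only: Bochner_Integration.integral_mult_right_zero)
    qed
    then show "(LINT x|lborel. h t x)
      = - (indicat_real {0<..} t * (cut t * ((exp (- (b * t)) - exp (- (a * t))) / t)))"
      using LBINT_exp_neg[OF assms(2), of t]
      by (cases "t > 0") (simp_all add: diff_divide_distrib right_diff_distrib)
  qed
  also have "(LINT t|lborel. - (indicat_real {0<..} t * (cut t * ((exp (- (b * t)) - exp (- (a * t))) / t))))
      = - pi * measure M {a<..b}"
    by (simp add: measure_Ioc_eq_integral_cut[OF assms] set_lebesgue_integral_def)
  finally have "measure M {a<..b} = - (1 / pi) * (LINT x|lborel. LINT t|lborel. h t x)"
    by simp
  also have "\<dots> = (LINT x|lborel. - (1 / pi) * (LINT t|lborel. h t x))"
    by (rule Bochner_Integration.integral_mult_right_zero[symmetric])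
  also have "\<dots> = (LBINT x:{a..b}. pdf x)"
    by (simp add: pdf_def set_lebesgue_integral_def h_def)
  finally show ?thesis .
qed

lemma pdf_nonneg:
  assumes "x > 0"
  shows "0 \<le> pdf x"
proof (rule ccontr)
  assume neg: "\<not> 0 \<le> pdf x"
  have "isCont pdf x"
    using continuous_on_pdf assms by (simp add: continuous_on_eq_continuous_at)
  then have "\<forall>\<^sub>F y in at x. pdf y < pdf x / 2"
    unfolding isCont_def using neg by (intro order_tendstoD) auto
  then obtain d where d: "d > 0" "\<And>y. y \<noteq> x \<Longrightarrow> dist y x < d \<Longrightarrow> pdf y < pdf x / 2"
    unfolding eventually_at by auto
  \<comment> \<open>Half the radius keeps the closed interval within distance less than d; the bound
    \<open>pdf x / 2\<close> is still negative, so the interval would have negative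
    probability.\<close>
  have le: "pdf y \<le> pdf x / 2" if "y \<in> {x..x + d / 2}" for y
    using that d neg by (cases "y = x") (auto simp: dist_real_def intro!: less_imp_le)
  have "(LBINT y:{x..x + d / 2}. pdf y) \<le> (LBINT y:{x..x + d / 2}. pdf x / 2)"
    using le assms by (intro set_integral_mono set_integrable_pdf)
      (auto simp: set_integrable_def emeasure_lborel_Icc_eq)
  also have "\<dots> = d / 2 * (pdf x / 2)"
    using d(1) by (simp add: set_lebesgue_integral_def)
  also have "\<dots> < 0"
    using neg d(1) by (auto simp: mult_less_0_iff)
  finally show False
    using measure_Ioc_eq_integral_pdf[of x "x + d / 2"] assms d(1) measure_nonneg[of M "{x<..x + d / 2}"]
    by simp
qed

text \<open>It suffices to compare rays. The integral formula covers only bounded intervals away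
  from 0, so the ray is cut at 0, where neither measure has mass to the left, and exhausted from
  inside.\<close>

theorem eq_density_pdf:
  assumes "AE x in M. x > 0"
  shows "M = density lborel (\<lambda>x. ennreal (if x > 0 then pdf x else 0))"
proof (rule measure_eqI_lessThan)
  let ?N = "density lborel (\<lambda>x. ennreal (if x > 0 then pdf x else 0))"
  show "sets M = sets borel" "sets ?N = sets borel" by auto
  show "emeasure M {x<..} < \<infinity>" for x
    by (simp add: emeasure_eq_measure)
  fix x :: real
  \<comment> \<open>The lower end is positive for every real x. For small n the interval may be
    empty, the trivial case a > b in \<open>Ioc\<close>.\<close>
  let ?U = "\<lambda>n. {max x (1 / real (Suc n))<..real n}"
  have Ioc: "emeasure M {a<..b} = emeasure ?N {a<..b}" if "0 < a" for a b
  proof (cases "a \<le> b")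
    case True
    have "emeasure M {a<..b} = ennreal (LBINT x:{a..b}. pdf x)"
      using that True by (simp add: emeasure_eq_measure measure_Ioc_eq_integral_pdf)
    also have "\<dots> = (\<integral>\<^sup>+x. ennreal (indicat_real {a..b} x *\<^sub>R pdf x) \<partial>lborel)"
      unfolding set_lebesgue_integral_def
      using set_integrable_pdf[OF that] that pdf_nonneg
      by (intro nn_integral_eq_integral[symmetric])
        (auto simp: set_integrable_def intro!: AE_I2 split: split_indicator)
    also have "\<dots> = (\<integral>\<^sup>+x. ennreal (if x > 0 then pdf x else 0) * indicator {a<..b} x \<partial>lborel)"
      using AE_lborel_singleton[of a] that
      by (intro nn_integral_cong_AE) (auto elim!: eventually_mono split: split_indicator)
    finally show ?thesis by (simp add: emeasure_density)
  qed simp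
  have inc: "incseq ?U"
  proof (rule incseq_SucI)
    fix n
    have "1 / real (Suc (Suc n)) \<le> 1 / real (Suc n)" by (intro divide_left_mono) auto
    then show "?U n \<subseteq> ?U (Suc n)" by auto
  qed
  have Un: "(\<Union>n. ?U n) = {max x 0<..}"
  proof
    have "0 < y" if "1 / real (Suc n) < y" for n y
      using that by (rule less_trans[rotated]) simp
    then show "(\<Union>n. ?U n) \<subseteq> {max x 0<..}"
      by (auto simp del: of_nat_Suc)
    show "{max x 0<..} \<subseteq> (\<Union>n. ?U n)"
    proof
      fix y assume y: "y \<in> {max x 0<..}"
      obtain N where N: "max y (1 / y) \<le> real N" using real_arch_simple by blast
      then have "1 / y < real (Suc N)" by simp
      then have "1 / real (Suc N) < y" using y by (simp add: field_simps)
      then have "y \<in> ?U N" using y N by simp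
      then show "y \<in> (\<Union>n. ?U n)" by blast
    qed
  qed
  have "emeasure M {x<..} = emeasure M {max x 0<..}"
    using assms by (intro emeasure_eq_AE) (auto elim!: eventually_mono)
  also have "\<dots> = (SUP n. emeasure M (?U n))"
    unfolding Un[symmetric] by (rule SUP_emeasure_incseq[symmetric]) (use inc in auto)
  also have "\<dots> = (SUP n. emeasure ?N (?U n))"
    by (intro SUP_cong refl Ioc) (simp add: less_max_iff_disj)
  also have "\<dots> = emeasure ?N {max x 0<..}"
    unfolding Un[symmetric] by (rule SUP_emeasure_incseq) (use inc in auto)
  also have "\<dots> = emeasure ?N {x<..}"
    by (intro emeasure_eq_AE) (auto simp: AE_density)
  finally show "emeasure M {x<..} = emeasure ?N {x<..}" .
qed

end

section \<open>Sums of independent lognormal variables\<close>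

lemma (in prob_space) holomorphic_laplace_transform:
  assumes [measurable]: "random_variable borel Y" and "AE \<omega> in M. 0 \<le> Y \<omega>"
  shows "laplace_transform M Y holomorphic_on {z. Re z > 0}"
  unfolding laplace_transform_def
proof (rule holomorphic_on_lebesgue_integral)
  fix z assume "z \<in> {z. Re z > 0}"
  then have z: "Re z > 0" by simp
  have sub: "Re w > 0" if "w \<in> ball z (Re z)" for w
    using that abs_Re_le_cmod[of "z - w"] by (auto simp: dist_norm)
  have "AE \<omega> in M. \<forall>w\<in>ball z (Re z). norm (exp (- w * complex_of_real (Y \<omega>))) \<le> 1"
    using assms(2) by eventually_elim (use sub in force)
  moreover have "ball z (Re z) \<subseteq> {z. Re z > 0}" using sub by auto
  ultimately show "\<exists>r>0. \<exists>g. ball z r \<subseteq> {z. Re z > 0} \<and> integrable M g \<and>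
      (AE \<omega> in M. \<forall>w\<in>ball z r. norm (exp (- w * complex_of_real (Y \<omega>))) \<le> g \<omega>)"
    using z by (intro exI[of _ "Re z"] conjI exI[of _ "\<lambda>_. 1"]) simp_all
qed (auto intro!: holomorphic_intros simp: open_halfspace_Re_gt)

text \<open>One absolutely continuous summand suffices: the mass at x is the average, over the law
  of Y, of the mass that the law of Z gives to x - u.\<close>

lemma (in prob_space) measure_distr_add_singleton_eq_0:
  fixes Y Z :: "'a \<Rightarrow> real"
  assumes "indep_var borel Z borel Y" and Z: "distributed M lborel Z f"
  shows "measure (distr M borel (\<lambda>\<omega>. Z \<omega> + Y \<omega>)) {x} = 0"
proof -
  have [measurable]: "random_variable borel Y" "random_variable borel Z"
    using assms(1) by (auto simp: indep_var_rv1 indep_var_rv2)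
  have [measurable]: "f \<in> borel_measurable lborel"
    using Z by (simp add: distributed_def)
  have "distr M borel Z = density lborel f"
    using Z by (simp add: distributed_def cong: distr_cong)
  then have "emeasure (distr M borel Z) {y} = 0" for y
    using AE_lborel_singleton[of y]
    by (auto simp: emeasure_density nn_integral_0_iff_AE elim!: eventually_mono split: split_indicator)
  moreover have fin: "finite_measure (distr M borel Y)" "finite_measure (distr M borel Z)"
    by (simp_all add: prob_space_distr prob_space.finite_measure)
  moreover have "{a. a + u \<in> {x}} = {x - u}" for u by auto
  \<comment> \<open>Commuting the convolution places the atomless law of \<open>Z\<close> in the
    integrand.\<close>
  ultimately have "emeasure (distr M borel (\<lambda>\<omega>. Z \<omega> + Y \<omega>)) {x} = 0"
    by (subst sum_indep_random_variable[OF assms(1)], simp, simp, subst convolution_commutative)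
      (simp_all add: convolution_emeasure fin)
  then show ?thesis by (simp add: measure_def)
qed

locale indep_lognormal = prob_space M for M :: "'a measure" +
  fixes X :: "nat \<Rightarrow> 'a \<Rightarrow> real" and \<mu> \<sigma> :: "nat \<Rightarrow> real" and n :: nat
  assumes n: "n \<ge> 1"
    and \<sigma>: "\<And>j. j \<in> {1..n} \<Longrightarrow> \<sigma> j > 0"
    and pdf_X: "\<And>j. j \<in> {1..n} \<Longrightarrow> has_pdf M (X j) (lognormal_density (\<mu> j) (\<sigma> j))"
    and indep: "indep_vars (\<lambda>_. borel) X {1..n}"
begin

definition S :: "'a \<Rightarrow> real" where "S \<omega> = (\<Sum>j = 1..n. X j \<omega>)"

definition \<Phi> :: "complex \<Rightarrow> complex" where "\<Phi> w = (\<Prod>j = 1..n. log_laplace (\<mu> j) (\<sigma> j) w)"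

text \<open>The product of the Gaussian factors exp((Im w)^2 / (2 \<sigma>^2)) at the edge |Im w| =
  \<pi> of the strip.\<close>

definition B :: real where "B = (\<Prod>j = 1..n. exp (pi\<^sup>2 / (2 * (\<sigma> j)\<^sup>2)))"

lemma borel_measurable_S [measurable]: "random_variable borel S"
proof -
  have "random_variable borel (X j)" if "j \<in> {1..n}" for j
    using pdf_X[OF that] by (auto simp: has_pdf_def distributed_def)
  then show ?thesis unfolding S_def[abs_def] by (rule borel_measurable_sum)
qed

lemma S_pos: "AE \<omega> in M. S \<omega> > 0"
proof -
  have "AE \<omega> in M. \<forall>j\<in>{1..n}. X j \<omega> > 0"
    using lognormal_AE_pos[OF pdf_X] by (intro AE_finite_allI) auto
  then show ?thesis
    by eventually_elim (use n in \<open>auto simp: S_def intro!: sum_pos\<close>)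
qed

lemma S_no_atoms: "measure (distr M borel S) {x} = 0"
proof -
  \<comment> \<open>\<open>X 1\<close> is split off; for n = 1 the remaining sum is empty and equals
    0.\<close>
  have ins: "{1..n} = insert 1 {2..n}" using n by auto
  have "indep_var borel (X 1) borel (\<lambda>\<omega>. \<Sum>j\<in>{2..n}. X j \<omega>)"
    using indep unfolding ins by (intro indep_vars_sum) auto
  moreover have "distributed M lborel (X 1) (\<lambda>x. ennreal (lognormal_density (\<mu> 1) (\<sigma> 1) x))"
    using pdf_X[of 1] n by (auto simp: has_pdf_def)
  moreover have "S = (\<lambda>\<omega>. X 1 \<omega> + (\<Sum>j\<in>{2..n}. X j \<omega>))"
    unfolding S_def ins by (simp add: fun_eq_iff)
  ultimately show ?thesis by (simp add: measure_distr_add_singleton_eq_0)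
qed

lemma holomorphic_\<Phi>: "\<Phi> holomorphic_on A"
  unfolding \<Phi>_def
  by (intro holomorphic_on_prod holomorphic_on_subset[OF holomorphic_log_laplace]) (use \<sigma> in auto)

lemma isCont_\<Phi>: "isCont \<Phi> w"
  using holomorphic_on_imp_continuous_on[OF holomorphic_\<Phi>[of UNIV]]
  by (simp add: continuous_on_eq_continuous_at)

text \<open>The second bound retains the decay of a single factor, which already forces the product
  to 0; the other factors are bounded by constants.\<close>

lemma norm_\<Phi>_le_B:
  assumes "\<bar>Im w\<bar> \<le> pi"
  shows "norm (\<Phi> w) \<le> B"
    and "norm (\<Phi> w) \<le> B * norm (log_laplace (\<mu> 1) (\<sigma> 1) (of_real (Re w)))"
proof -
  have "(Im w)\<^sup>2 \<le> pi\<^sup>2"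
    using assms by (metis abs_ge_zero power2_abs power_mono)
  then have exp_le: "exp ((Im w)\<^sup>2 / (2 * (\<sigma> j)\<^sup>2)) \<le> exp (pi\<^sup>2 / (2 * (\<sigma> j)\<^sup>2))" for j
    by (simp add: divide_right_mono)
  have le: "norm (log_laplace (\<mu> j) (\<sigma> j) w) \<le> exp (pi\<^sup>2 / (2 * (\<sigma> j)\<^sup>2))" if "j \<in> {1..n}" for j
    using norm_log_laplace_le_exp[OF pdf_X[OF that] \<sigma>[OF that], of w] exp_le[of j] by linarith
  show "norm (\<Phi> w) \<le> B"
    unfolding \<Phi>_def B_def prod_norm[symmetric] by (intro prod_mono) (use le in auto)
  have ins: "{1..n} = insert 1 {2..n}" using n by auto
  have "norm (log_laplace (\<mu> 1) (\<sigma> 1) w)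
      \<le> exp (pi\<^sup>2 / (2 * (\<sigma> 1)\<^sup>2)) * norm (log_laplace (\<mu> 1) (\<sigma> 1) (of_real (Re w)))"
    using norm_log_laplace_le[OF \<sigma>, of 1 "\<mu> 1" w] n mult_right_mono[OF exp_le norm_ge_zero]
    by (force intro: order_trans)
  moreover have "(\<Prod>j\<in>{2..n}. norm (log_laplace (\<mu> j) (\<sigma> j) w)) \<le> (\<Prod>j\<in>{2..n}. exp (pi\<^sup>2 / (2 * (\<sigma> j)\<^sup>2)))"
    by (intro prod_mono) (use le in auto)
  ultimately have "norm (\<Phi> w) \<le>
      (exp (pi\<^sup>2 / (2 * (\<sigma> 1)\<^sup>2)) * norm (log_laplace (\<mu> 1) (\<sigma> 1) (of_real (Re w)))) *
      (\<Prod>j\<in>{2..n}. exp (pi\<^sup>2 / (2 * (\<sigma> j)\<^sup>2)))"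
    unfolding \<Phi>_def prod_norm[symmetric] ins
    by (subst prod.insert) (auto intro!: mult_mono prod_nonneg)
  then show "norm (\<Phi> w) \<le> B * norm (log_laplace (\<mu> 1) (\<sigma> 1) (of_real (Re w)))"
    unfolding B_def ins by (subst prod.insert) (auto simp: mult_ac)
qed

section \<open>Continuation and boundary values of the Laplace transform of the sum\<close>

lemma laplace_transform_of_real:
  assumes "r > 0"
  shows "laplace_transform M S (of_real r) = \<Phi> (Ln (of_real r))"
proof -
  have int: "integrable M (\<lambda>\<omega>. exp (- r * X j \<omega>))" if "j \<in> {1..n}" for j
  proof (rule integrable_const_bound)
    show "AE \<omega> in M. norm (exp (- r * X j \<omega>)) \<le> 1"
      using lognormal_AE_pos[OF pdf_X[OF that]] by eventually_elim (use assms in auto)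
    have [measurable]: "random_variable borel (X j)"
      using pdf_X[OF that] by (auto simp: has_pdf_def distributed_def)
    show "(\<lambda>\<omega>. exp (- r * X j \<omega>)) \<in> borel_measurable M" by measurable
  qed
  have "laplace_transform M S (of_real r) = (LINT \<omega>|M. complex_of_real (exp (- r * S \<omega>)))"
    unfolding laplace_transform_def by (simp flip: exp_of_real)
  also have "\<dots> = of_real (expectation (\<lambda>\<omega>. \<Prod>j = 1..n. exp (- r * X j \<omega>)))"
  proof -
    have "exp (- r * S \<omega>) = (\<Prod>j = 1..n. exp (- r * X j \<omega>))" for \<omega>
      unfolding S_def sum_distrib_left by (rule exp_sum) simp
    then show ?thesis by (simp only: integral_complex_of_real)
  qed
  also have "expectation (\<lambda>\<omega>. \<Prod>j = 1..n. exp (- r * X j \<omega>)) = (\<Prod>j = 1..n. expectation (\<lambda>\<omega>. exp (- r * X j \<omega>)))"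
    by (intro indep_vars_lebesgue_integral indep_vars_compose2[OF indep] int) auto
  also have "of_real \<dots> = \<Phi> (of_real (ln r))"
    unfolding \<Phi>_def of_real_prod by (intro prod.cong refl log_laplace_ln[OF pdf_X assms, symmetric])
  finally show ?thesis using assms by (simp add: Ln_of_real)
qed

text \<open>Identity theorem: both sides are holomorphic on the right half-plane and agree on the
  positive reals, which accumulate at 1.\<close>

lemma laplace_transform_eq:
  assumes "Re z > 0"
  shows "laplace_transform M S z = \<Phi> (Ln z)"
proof -
  have "laplace_transform M S z - \<Phi> (Ln z) = 0"
  proof (rule analytic_continuation[where S = "{z. Re z > 0}" and U = "of_real ` {0<..}" and \<xi> = 1
        and f = "\<lambda>z. laplace_transform M S z - \<Phi> (Ln z)"])
    have "(\<lambda>z. \<Phi> (Ln z)) holomorphic_on {z. Re z > 0}"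
      by (rule holomorphic_on_compose_gen[OF _ holomorphic_\<Phi>, unfolded o_def, of _ _ UNIV])
        (auto intro!: holomorphic_intros simp: complex_nonpos_Reals_iff)
    moreover have "laplace_transform M S holomorphic_on {z. Re z > 0}"
      by (rule holomorphic_laplace_transform) (use S_pos in \<open>auto elim!: eventually_mono\<close>)
    ultimately show "(\<lambda>z. laplace_transform M S z - \<Phi> (Ln z)) holomorphic_on {z. Re z > 0}"
      by (intro holomorphic_on_diff)
    show "connected {z. 0 < Re z}"
      by (intro convex_connected convex_halfspace_Re_gt)
    show "(1::complex) islimpt of_real ` {0<..}"
    proof -
      have "(\<lambda>n. complex_of_real (1 + 1 / real (Suc n))) \<longlonglongrightarrow> of_real (1 + 0)"
        by (intro tendsto_intros) (use LIMSEQ_inverse_real_of_nat in \<open>simp add: inverse_eq_divide\<close>)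
      then show ?thesis
        unfolding islimpt_sequential
        by (intro exI[of _ "\<lambda>n. complex_of_real (1 + 1 / real (Suc n))"]) (auto simp: add_pos_pos simp del: of_real_add of_nat_Suc)
    qed
  qed (use assms laplace_transform_of_real in \<open>auto simp: open_halfspace_Re_gt\<close>)
  then show ?thesis by simp
qed

text \<open>The imaginary axis is the boundary of the previous lemma's domain. It is approached from
  the right, by dominated convergence on one side and continuity of \<open>\<Phi>\<close> and
  \<open>Ln\<close> on the other; this is the link to the characteristic function.\<close>

lemma laplace_transform_imaginary:
  assumes "t > 0"
  shows "laplace_transform M S (\<i> * of_real t) = \<Phi> (Ln (\<i> * of_real t))"
proof -
  let ?z = "\<lambda>k. Complex (1 / real (Suc k)) t"
  have "(\<lambda>k. Complex (1 / real (Suc k)) t) \<longlonglongrightarrow> Complex 0 t"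
    by (intro tendsto_intros) (use LIMSEQ_inverse_real_of_nat in \<open>simp add: inverse_eq_divide\<close>)
  moreover have it: "Complex 0 t = \<i> * of_real t" by (simp add: complex_eq_iff)
  ultimately have lim: "?z \<longlonglongrightarrow> \<i> * of_real t" by simp
  have "(\<lambda>k. laplace_transform M S (?z k)) \<longlonglongrightarrow> laplace_transform M S (\<i> * of_real t)"
    unfolding laplace_transform_def
  proof (rule integral_dominated_convergence[where w = "\<lambda>_. 1"])
    show "AE \<omega> in M. (\<lambda>k. exp (- ?z k * of_real (S \<omega>))) \<longlonglongrightarrow> exp (- (\<i> * of_real t) * of_real (S \<omega>))"
      by (intro AE_I2 tendsto_intros lim)
    show "AE \<omega> in M. norm (exp (- ?z k * of_real (S \<omega>))) \<le> 1" for k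
      using S_pos by eventually_elim simp
  qed auto
  moreover have "(\<lambda>k. \<Phi> (Ln (?z k))) \<longlonglongrightarrow> \<Phi> (Ln (\<i> * of_real t))"
    using assms
    by (intro isCont_tendsto_compose[OF isCont_\<Phi>] tendsto_Ln lim) (auto simp: complex_nonpos_Reals_iff)
  ultimately show ?thesis
    using LIMSEQ_unique laplace_transform_eq by simp
qed

text \<open>This is \<phi>(\<i>z). \<open>Ln (\<i> * z)\<close> would jump across the positive
  imaginary axis; adding \<i>\<pi>/2 after taking \<open>Ln z\<close> makes \<open>\<psi>\<close>
  holomorphic across that edge.\<close>

definition \<psi> :: "complex \<Rightarrow> complex" where "\<psi> z = \<Phi> (Ln z + \<i> * of_real pi / 2)"

text \<open>For Re z >= 0 the argument of z lies in [-\<pi>/2, \<pi>/2], so adding \<pi>/2 stays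
  within the principal range.\<close>

lemma \<psi>_eq: "z \<noteq> 0 \<Longrightarrow> Re z \<ge> 0 \<Longrightarrow> \<psi> z = \<Phi> (Ln (\<i> * z))"
  by (simp add: \<psi>_def Ln_times_ii)

lemma not_nonpos_Reals: "0 < Re z + Im z \<Longrightarrow> z \<notin> \<real>\<^sub>\<le>\<^sub>0"
  by (auto simp: complex_nonpos_Reals_iff)

lemma quarter_plane_char: "quarter_plane_char (distr M borel S) \<psi> B"
proof -
  interpret D: real_distribution "distr M borel S"
    by (rule real_distribution_distr) simp
  have Im_le: "\<bar>Im (Ln z + \<i> * of_real pi / 2)\<bar> \<le> pi" if "Re z \<ge> 0" "z \<noteq> 0" for z
    using Re_Ln_pos_le[OF that(2)] that(1) by (simp add: abs_le_iff)
  show ?thesis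
  proof
    show "measure (distr M borel S) {x} = 0" for x by (rule S_no_atoms)
    show "\<psi> holomorphic_on {z. 0 < Re z + Im z}"
      unfolding \<psi>_def
      by (rule holomorphic_on_compose_gen[OF _ holomorphic_\<Phi>, unfolded o_def, of _ _ UNIV])
        (auto intro!: holomorphic_intros simp: not_nonpos_Reals)
    show "norm (\<psi> z) \<le> B" if "0 \<le> Re z" "0 \<le> Im z" "z \<noteq> 0" for z
      unfolding \<psi>_def using that by (intro norm_\<Phi>_le_B Im_le)
    show "\<exists>R. \<forall>z. Re z \<ge> 0 \<longrightarrow> Im z \<ge> 0 \<longrightarrow> norm z \<ge> R \<longrightarrow> norm (\<psi> z) \<le> e" if "e > 0" for e
    proof -
      have "((\<lambda>r. B * norm (log_laplace (\<mu> 1) (\<sigma> 1) (of_real (ln r)))) \<longlongrightarrow> 0) at_top"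
        by (intro tendsto_mult_right_zero tendsto_norm_zero log_laplace_tendsto_0[OF pdf_X]) (use n in auto)
      then have "\<forall>\<^sub>F r in at_top. B * norm (log_laplace (\<mu> 1) (\<sigma> 1) (of_real (ln r))) < e"
        using that by (rule order_tendstoD)
      then obtain R where R: "\<And>r. r \<ge> R \<Longrightarrow> B * norm (log_laplace (\<mu> 1) (\<sigma> 1) (of_real (ln r))) < e"
        by (auto simp: eventually_at_top_linorder)
      \<comment> \<open>The bound depends on z only through Re (Ln z) = ln |z|, so the decay is
        uniform in direction. The 1 in the maximum excludes z = 0.\<close>
      have "norm (\<psi> z) \<le> e" if z: "Re z \<ge> 0" "norm z \<ge> max R 1" for z
      proof -
        have "z \<noteq> 0" using z by auto
        then have "norm (\<psi> z) \<le> B * norm (log_laplace (\<mu> 1) (\<sigma> 1) (of_real (ln (norm z))))"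
          unfolding \<psi>_def using norm_\<Phi>_le_B(2)[OF Im_le] z by simp
        also have "\<dots> < e" using R z by simp
        finally show ?thesis by simp
      qed
      then show ?thesis by (intro exI[of _ "max R 1"]) blast
    qed
    show "\<psi> (of_real t) = char (distr M borel S) (- t)" if "t > 0" for t
    proof -
      have "char (distr M borel S) (- t) = laplace_transform M S (\<i> * of_real t)"
        unfolding char_def laplace_transform_def by (simp add: integral_distr mult_ac)
      also have "\<dots> = \<psi> (of_real t)"
        using that by (simp add: laplace_transform_imaginary \<psi>_eq)
      finally show ?thesis by simp
    qed
  qed
qed

text \<open>Provides the witness that makes the choice in \<open>laplace_ext\<close> a genuine
  continuation.\<close>

lemma laplace_continuation_\<Phi>: "laplace_continuation M S (\<lambda>z. \<Phi> (Ln z))"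
  unfolding laplace_continuation_def
proof (intro conjI allI impI)
  show "(\<lambda>z. \<Phi> (Ln z)) holomorphic_on - \<real>\<^sub>\<le>\<^sub>0"
    by (rule holomorphic_on_compose_gen[OF _ holomorphic_\<Phi>, unfolded o_def, of _ _ UNIV])
      (auto intro!: holomorphic_intros)
qed (simp add: laplace_transform_eq)

lemma laplace_continuation_ext: "laplace_continuation M S (laplace_ext M S)"
  unfolding laplace_ext_def by (rule someI[where P = "laplace_continuation M S", OF laplace_continuation_\<Phi>])

text \<open>Since -t + \<i>\<epsilon> = \<i>(\<epsilon> + \<i>t), approaching the cut from above
  means approaching \<i>t from the right, and \<open>\<psi>\<close> is continuous there.\<close>

lemma tendsto_upper_boundary:
  assumes "t > 0"
  shows "((\<lambda>\<epsilon>. laplace_ext M S (Complex (- t) \<epsilon>)) \<longlongrightarrow> \<psi> (\<i> * of_real t)) (at_right 0)"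
proof -
  have "((\<lambda>\<epsilon>. Complex \<epsilon> t) \<longlongrightarrow> Complex 0 t) (at_right 0)"
    by (intro tendsto_intros)
  moreover have it: "Complex 0 t = \<i> * of_real t" by (simp add: complex_eq_iff)
  moreover have "isCont \<psi> (\<i> * of_real t)"
    unfolding \<psi>_def using assms
    by (intro isCont_o2[OF _ isCont_\<Phi>] continuous_intros) (auto simp: complex_nonpos_Reals_iff)
  ultimately have "((\<lambda>\<epsilon>. \<psi> (Complex \<epsilon> t)) \<longlongrightarrow> \<psi> (\<i> * of_real t)) (at_right 0)"
    by (metis isCont_tendsto_compose)
  moreover have "\<forall>\<^sub>F \<epsilon> in at_right 0. \<psi> (Complex \<epsilon> t) = laplace_ext M S (Complex (- t) \<epsilon>)"
    using eventually_at_right_less[of 0]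
  proof eventually_elim
    case (elim \<epsilon>)
    have "laplace_ext M S (Complex (- t) \<epsilon>) = \<Phi> (Ln (Complex (- t) \<epsilon>))"
      using elim by (intro laplace_continuation_unique[OF laplace_continuation_ext laplace_continuation_\<Phi>])
        (auto simp: complex_nonpos_Reals_iff)
    also have "\<dots> = \<Phi> (Ln (\<i> * Complex \<epsilon> t))"
      by (intro arg_cong[of _ _ "\<lambda>z. \<Phi> (Ln z)"]) (simp add: complex_eq_iff)
    also have "\<dots> = \<psi> (Complex \<epsilon> t)"
      using elim assms by (intro \<psi>_eq[symmetric]) (auto simp: complex_eq_iff)
    finally show ?case by (rule sym)
  qed
  ultimately show ?thesis by (rule Lim_transform_eventually)
qed

lemma upper_boundary_value_eq:
  assumes "t > 0"
  shows "upper_boundary_value (laplace_ext M S) t = \<psi> (\<i> * of_real t)"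
  unfolding upper_boundary_value_def
  by (rule tendsto_Lim[OF _ tendsto_upper_boundary[OF assms]]) simp

end

text \<open>\<open>SOME\<close>, \<open>Lim\<close> and the Bochner integral all have default
  values. The conjuncts before the density claim certify that the continuation, the boundary limits
  and the integrals exist.\<close>

theorem proposition1:
  fixes M :: "'a measure" and X :: "nat \<Rightarrow> 'a \<Rightarrow> real"
    and \<mu> \<sigma> :: "nat \<Rightarrow> real" and n :: nat
  assumes "prob_space M"
    and "n \<ge> 1"
    and "\<And>j. j \<in> {1..n} \<Longrightarrow> \<sigma> j > 0"
    and "\<And>j. j \<in> {1..n} \<Longrightarrow> has_pdf M (X j) (lognormal_density (\<mu> j) (\<sigma> j))"
    and "prob_space.indep_vars M (\<lambda>_. borel) X {1..n}"
  shows "let S = (\<lambda>\<omega>. \<Sum>j = 1..n. X j \<omega>);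
             \<phi> = laplace_ext M S
         in laplace_continuation M S \<phi> \<and>
            (\<forall>t>0. ((\<lambda>\<epsilon>. \<phi> (Complex (- t) \<epsilon>)) \<longlongrightarrow> upper_boundary_value \<phi> t) (at_right 0)) \<and>
            (\<forall>x>0. set_integrable lborel {0<..}
                     (\<lambda>t. Im (upper_boundary_value \<phi> t) * exp (- t * x))) \<and>
            has_pdf M S
              (\<lambda>x. if x > 0
                   then - (1 / pi) *
                     (LINT t:{0<..}|lborel. Im (upper_boundary_value \<phi> t) * exp (- t * x))
                   else 0)"
proof -
  interpret indep_lognormal M X \<mu> \<sigma> n
    using assms by (intro indep_lognormal.intro indep_lognormal_axioms.intro)
  interpret Q: quarter_plane_char "distr M borel S" \<psi> B
    by (rule quarter_plane_char)
  let ?\<phi> = "laplace_ext M S"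
  \<comment> \<open>The two functions are compared only for t > 0, which is all that integrals over
    the open half-line see.\<close>
  have cut: "Im (upper_boundary_value ?\<phi> t) = Q.cut t" if "t > 0" for t
    using that by (simp add: upper_boundary_value_eq Q.cut_def)
  have pdf: "(LINT t:{0<..}|lborel. Im (upper_boundary_value ?\<phi> t) * exp (- t * x))
      = (LINT t:{0<..}|lborel. Q.cut t * exp (- t * x))" for x
    by (intro set_lebesgue_integral_cong) (auto simp: cut)
  have "set_integrable lborel {0<..} (\<lambda>t. Im (upper_boundary_value ?\<phi> t) * exp (- t * x))" if "x > 0" for x
    using Q.set_integrable_cut_exp[OF that] by (rule set_integrable_cong[THEN iffD1, rotated -1]) (auto simp: cut)
  moreover have "has_pdf M S (\<lambda>x. if x > 0 then Q.pdf x else 0)"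
    unfolding has_pdf_def distributed_def
  proof (intro conjI allI)
    show "0 \<le> (if x > 0 then Q.pdf x else 0)" for x by (simp add: Q.pdf_nonneg)
    have "AE x in distr M borel S. x > 0"
      using S_pos by (simp add: AE_distr_iff)
    from Q.eq_density_pdf[OF this]
    show "distr M lborel S = density lborel (\<lambda>x. ennreal (if x > 0 then Q.pdf x else 0))"
      by (simp cong: distr_cong)
  qed auto
  moreover have "((\<lambda>\<epsilon>. ?\<phi> (Complex (- t) \<epsilon>)) \<longlongrightarrow> upper_boundary_value ?\<phi> t) (at_right 0)" if "t > 0" for t
    using tendsto_upper_boundary[OF that] upper_boundary_value_eq[OF that] by simp
  ultimately show ?thesis
    using laplace_continuation_ext
    unfolding Let_def S_def[abs_def, symmetric] pdf Q.pdf_def by blast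
qed

end
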